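(* Let $F$ be a free group of finite rank with fixed basis $A$ and let $H,K$ be non-trivial finitely generated subgroups of $F$, with maximum finite-index extensions $H_{\mathsf{fi}}$ and $K_{\mathsf{fi}}$ in $F$. The following are equivalent: \begin{itemize} \item $H_{\mathsf{fi}}=K_{\mathsf{fi}}$; \item $\mathsf{t}_H(1)=\mathsf{t}_K(1)$ and $\widetilde L_{\tau_H(1)}(H)=\widetilde L_{\tau_K(1)}(K)$; \item $\mathsf{t}_H(1)=\mathsf{t}_K(1)$ and $L_{\tau_H(1)}(H)=L_{\tau_K(1)}(K)$. \end{itemize}
   Context: Words: $F$ is a free group with finite basis $A$; $\bar A=\{\bar a: a\in A\}$ is a disjoint copy of $A$ and $\tilde A=A\cup\bar A$, with $\bar{\bar a}=a$. Elements of $F$ are identified with reduced words over $\tilde A$ (no factor $a\bar a$, $a\in\tilde A$). Stallings graph: each finitely generated $H\le F$ has a unique representation $\mathcal{A}(H)=(\Gamma(H),1)$, where $\Gamma(H)$ is a finite connected directed graph with edges labeled by $A$ and $1$ is a designated vertex, such that (i) for each $a\in A$ every vertex is the source of at most one and the target of at most one $a$-labeled edge; (ii) every vertex except possibly $1$ has degree (in-degree plus out-degree) at least $2$; (iii) a reduced word is in $H$ iff it labels a loop at $1$. Here an edge $(p,a,q)$, $a\in A$, is read as $p\xrightarrow{a}q$ and $q\xrightarrow{\bar a}p$, so paths are labeled by words over $\tilde A$. Core and tail: for $H$ non-trivial, if every vertex of $\Gamma(H)$ has degree at least $2$, then $\mathsf{cc}(\Gamma(H))=\Gamma(H)$, the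 tail is empty, $\mathsf{t}_H(1)$ is the empty word and $\tau_H(1)=1$. Otherwise vertex $1$ has degree $1$; the tail consists of $1$ and all degree-$2$ vertices that can be connected to $1$ through other degree-$2$ vertices, the core $\mathsf{cc}(\Gamma(H))$ is the rest of $\Gamma(H)$, $\mathsf{t}_H(1)$ is the shortest word labeling a path from $1$ to a vertex of $\mathsf{cc}(\Gamma(H))$, and $\tau_H(1)$ is the vertex of $\mathsf{cc}(\Gamma(H))$ thus reached. Languages: for a vertex $p$ of $\mathsf{cc}(\Gamma(H))$, $\widetilde L_p(H)$ is the set of (possibly non-reduced) words in $\tilde A^*$ labeling a path in $\mathsf{cc}(\Gamma(H))$ starting at $p$, and $L_p(H)$ is the set of reduced words in $\widetilde L_p(H)$. Finite-index extensions: a finite-index extension of $H$ is a subgroup $G\le F$ with $H\le G$ and $[G:H]<\infty$. It is known that a finitely generated $H$ has a maximum finite-index extension, denoted $H_{\mathsf{fi}}$. *)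

theory Defs
  imports "HOL-Algebra.Coset" "HOL-Algebra.Generated_Groups"
begin

section \<open>Words and the free group on a basis\<close>

text \<open>\<open>Bar a\<close> is the formal inverse of the basis element \<open>a\<close>.\<close>

datatype 'a letter = Pos 'a | Bar 'a

fun bar :: "'a letter \<Rightarrow> 'a letter" where
  "bar (Pos a) = Bar a"
| "bar (Bar a) = Pos a"

definition letters :: "'a set \<Rightarrow> 'a letter set" where
  "letters A = Pos ` A \<union> Bar ` A"

definition reduced :: "'a letter list \<Rightarrow> bool" where
  "reduced w \<longleftrightarrow> \<not> (\<exists>u x v. w = u @ [x, bar x] @ v)"

fun cancel_cons :: "'a letter \<Rightarrow> 'a letter list \<Rightarrow> 'a letter list" where
  "cancel_cons x [] = [x]"
| "cancel_cons x (y # w) = (if y = bar x then w else x # y # w)"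

definition reduce :: "'a letter list \<Rightarrow> 'a letter list" where
  "reduce w = foldr cancel_cons w []"

definition free_group :: "'a set \<Rightarrow> 'a letter list monoid" where
  "free_group A = \<lparr>carrier = {w. set w \<subseteq> letters A \<and> reduced w},
                   mult = (\<lambda>u v. reduce (u @ v)), one = []\<rparr>"

lemma bar_bar [simp]: "bar (bar x) = x"
  by (cases x) auto

lemma bar_in_letters [simp]: "bar x \<in> letters A \<longleftrightarrow> x \<in> letters A"
  by (cases x) (auto simp: letters_def)

lemma reduced_Nil [simp]: "reduced []"
  by (simp add: reduced_def)

lemma reduced_Cons:
  "reduced (x # w) \<longleftrightarrow> reduced w \<and> (w = [] \<or> hd w \<noteq> bar x)"
proof -
  have "(\<exists>u y v. x # w = u @ [y, bar y] @ v) \<longleftrightarrow>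
        (\<exists>v. w = bar x # v) \<or> (\<exists>u y v. w = u @ [y, bar y] @ v)"
    (is "?L \<longleftrightarrow> ?R")
  proof
    assume ?L
    then obtain u y v where "x # w = u @ [y, bar y] @ v" by blast
    then show ?R by (cases u) auto
  next
    assume ?R
    then show ?L
    proof
      assume "\<exists>v. w = bar x # v"
      then obtain v where "x # w = [] @ [x, bar x] @ v" by auto
      then show ?L by blast
    next
      assume "\<exists>u y v. w = u @ [y, bar y] @ v"
      then obtain u y v where "x # w = (x # u) @ [y, bar y] @ v" by auto
      then show ?L by blast
    qed
  qed
  moreover have "(\<exists>v. w = bar x # v) \<longleftrightarrow> w \<noteq> [] \<and> hd w = bar x"
    by (cases w) auto
  ultimately show ?thesis unfolding reduced_def by blast
qed

lemma reduced_cancel_cons: "reduced w \<Longrightarrow> reduced (cancel_cons x w)"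
  by (cases w) (auto simp: reduced_Cons)

lemma set_cancel_cons: "set (cancel_cons x w) \<subseteq> insert x (set w)"
  by (cases w) auto

lemma reduced_foldr_cancel_cons: "reduced w \<Longrightarrow> reduced (foldr cancel_cons u w)"
  by (induction u) (auto intro: reduced_cancel_cons)

lemma reduced_reduce: "reduced (reduce w)"
  by (simp add: reduce_def reduced_foldr_cancel_cons)

lemma set_reduce: "set (reduce w) \<subseteq> set w"
  unfolding reduce_def by (induction w) (use set_cancel_cons in fastforce)+

lemma cancel_cons_reduced: "reduced (x # w) \<Longrightarrow> cancel_cons x w = x # w"
  by (cases w) (auto simp: reduced_Cons)

lemma reduce_reduced: "reduced w \<Longrightarrow> reduce w = w"
  unfolding reduce_def
  by (induction w) (auto simp: cancel_cons_reduced, simp add: cancel_cons_reduced reduced_Cons)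

lemma cancel_cons_bar:
  assumes "reduced w" shows "cancel_cons x (cancel_cons (bar x) w) = w"
proof (cases w)
  case (Cons y v)
  then show ?thesis using assms by (cases v) (auto simp: reduced_Cons)
qed auto

lemma foldr_cancel_cons_cancel_cons:
  assumes "reduced z"
  shows "foldr cancel_cons (cancel_cons x y) z = cancel_cons x (foldr cancel_cons y z)"
proof (cases y)
  case (Cons c v)
  then show ?thesis
    using cancel_cons_bar[OF reduced_foldr_cancel_cons[OF assms]] by auto
qed auto

lemma foldr_cancel_cons_reduce:
  assumes "reduced z"
  shows "foldr cancel_cons (reduce u) z = foldr cancel_cons u z"
  by (induction u) (simp_all add: reduce_def foldr_cancel_cons_cancel_cons[OF assms])

lemma reduce_append: "reduce (u @ v) = foldr cancel_cons u (reduce v)"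
  by (simp add: reduce_def)

lemma reduce_append_right: "reduce (u @ reduce v) = reduce (u @ v)"
  by (simp add: reduce_append reduce_reduced reduced_reduce)

lemma reduce_append_left: "reduce (reduce u @ v) = reduce (u @ v)"
  by (simp add: reduce_append foldr_cancel_cons_reduce reduced_reduce)

lemma reduce_inverse: "reduce (map bar (rev w) @ w) = []"
proof (induction w)
  case (Cons x w)
  have "reduce (map bar (rev (x # w)) @ x # w)
        = foldr cancel_cons (map bar (rev w)) (cancel_cons (bar x) (cancel_cons x (reduce w)))"
    by (simp add: reduce_def)
  also have "cancel_cons (bar x) (cancel_cons x (reduce w)) = reduce w"
    using cancel_cons_bar[of "reduce w" "bar x"] by (simp add: reduced_reduce)
  finally show ?case using Cons.IH by (simp add: reduce_append)
qed (simp add: reduce_def)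

lemma group_free_group: "group (free_group A)"
proof (rule groupI)
  fix u v assume "u \<in> carrier (free_group A)" "v \<in> carrier (free_group A)"
  then show "u \<otimes>\<^bsub>free_group A\<^esub> v \<in> carrier (free_group A)"
    using set_reduce[of "u @ v"] by (auto simp: free_group_def reduced_reduce)
next
  fix u assume u: "u \<in> carrier (free_group A)"
  let ?v = "reduce (map bar (rev u))"
  have "?v \<in> carrier (free_group A)"
    using u set_reduce[of "map bar (rev u)"]
    by (force simp: free_group_def reduced_reduce)
  moreover have "?v \<otimes>\<^bsub>free_group A\<^esub> u = \<one>\<^bsub>free_group A\<^esub>"
    by (simp add: free_group_def reduce_append_left reduce_inverse)
  ultimately show "\<exists>v\<in>carrier (free_group A). v \<otimes>\<^bsub>free_group A\<^esub> u = \<one>\<^bsub>free_group A\<^esub>"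
    by blast
qed (auto simp: free_group_def reduce_append_left reduce_append_right reduce_reduced)

section \<open>Finitely generated subgroups and finite-index extensions\<close>

definition fin_gen_subgroup :: "'g set \<Rightarrow> ('g, 'r) monoid_scheme \<Rightarrow> bool" where
  "fin_gen_subgroup H F \<longleftrightarrow>
     subgroup H F \<and> (\<exists>S. finite S \<and> S \<subseteq> carrier F \<and> H = generate F S)"

definition fi_extension :: "('g, 'r) monoid_scheme \<Rightarrow> 'g set \<Rightarrow> 'g set \<Rightarrow> bool" where
  "fi_extension F H G \<longleftrightarrow>
     subgroup G F \<and> H \<subseteq> G \<and> finite (rcosets\<^bsub>F\<lparr>carrier := G\<rparr>\<^esub> H)"

text \<open>The maximum (not just a maximal) finite-index extension with respect to inclusion.\<close>

definition max_fi_extension :: "('g, 'r) monoid_scheme \<Rightarrow> 'g set \<Rightarrow> 'g set" where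
  "max_fi_extension F H =
     (THE M. fi_extension F H M \<and> (\<forall>G. fi_extension F H G \<longrightarrow> G \<subseteq> M))"

section \<open>Labelled graphs and Stallings graphs\<close>

text \<open>An edge \<open>(p, a, q)\<close> goes from \<open>p\<close> to \<open>q\<close> and has label \<open>a\<close>.\<close>

record ('v, 'a) lgraph =
  verts :: "'v set"
  edges :: "('v \<times> 'a \<times> 'v) set"

fun lstep :: "('v, 'a) lgraph \<Rightarrow> 'v \<Rightarrow> 'a letter \<Rightarrow> 'v \<Rightarrow> bool" where
  "lstep \<Gamma> p (Pos a) q \<longleftrightarrow> (p, a, q) \<in> edges \<Gamma>"
| "lstep \<Gamma> p (Bar a) q \<longleftrightarrow> (q, a, p) \<in> edges \<Gamma>"

fun lpath :: "('v, 'a) lgraph \<Rightarrow> 'v \<Rightarrow> 'a letter list \<Rightarrow> 'v \<Rightarrow> bool" where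
  "lpath \<Gamma> p [] q \<longleftrightarrow> p \<in> verts \<Gamma> \<and> p = q"
| "lpath \<Gamma> p (x # w) q \<longleftrightarrow> p \<in> verts \<Gamma> \<and> (\<exists>r. lstep \<Gamma> p x r \<and> lpath \<Gamma> r w q)"

text \<open>A loop edge contributes 2 to the degree of its vertex.\<close>

definition degree :: "('v, 'a) lgraph \<Rightarrow> 'v \<Rightarrow> nat" where
  "degree \<Gamma> v = card {(p, a, q) \<in> edges \<Gamma>. q = v} + card {(p, a, q) \<in> edges \<Gamma>. p = v}"

text \<open>The pair \<open>(\<Gamma>, b)\<close>, with designated vertex \<open>b\<close>, represents \<open>H\<close>. It is determined by \<open>H\<close>
  up to isomorphism.\<close>

definition stallings_graph ::
    "'a set \<Rightarrow> 'a letter list set \<Rightarrow> ('v, 'a) lgraph \<Rightarrow> 'v \<Rightarrow> bool" where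
  "stallings_graph A H \<Gamma> b \<longleftrightarrow>
     finite (verts \<Gamma>) \<and> b \<in> verts \<Gamma> \<and> edges \<Gamma> \<subseteq> verts \<Gamma> \<times> A \<times> verts \<Gamma> \<and> finite (edges \<Gamma>) \<and>
     (\<forall>p\<in>verts \<Gamma>. \<forall>q\<in>verts \<Gamma>. \<exists>w. lpath \<Gamma> p w q) \<and>
     (\<forall>p a q q'. (p, a, q) \<in> edges \<Gamma> \<and> (p, a, q') \<in> edges \<Gamma> \<longrightarrow> q = q') \<and>
     (\<forall>p p' a q. (p, a, q) \<in> edges \<Gamma> \<and> (p', a, q) \<in> edges \<Gamma> \<longrightarrow> p = p') \<and>
     (\<forall>v\<in>verts \<Gamma>. v \<noteq> b \<longrightarrow> degree \<Gamma> v \<ge> 2) \<and>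
     (\<forall>w. set w \<subseteq> letters A \<and> reduced w \<longrightarrow> (w \<in> H \<longleftrightarrow> lpath \<Gamma> b w b))"

section \<open>Core, tail and languages\<close>

definition no_tail :: "('v, 'a) lgraph \<Rightarrow> bool" where
  "no_tail \<Gamma> \<longleftrightarrow> (\<forall>v\<in>verts \<Gamma>. degree \<Gamma> v \<ge> 2)"

text \<open>If there is a tail, it is the set of vertices reachable from \<open>b\<close> along paths all of
  whose vertices after \<open>b\<close> have degree 2; this includes \<open>b\<close> itself, via the empty path.\<close>

definition tail_verts :: "('v, 'a) lgraph \<Rightarrow> 'v \<Rightarrow> 'v set" where
  "tail_verts \<Gamma> b =
     (if no_tail \<Gamma> then {}
      else {v. (\<lambda>p q. (\<exists>x. lstep \<Gamma> p x q) \<and> degree \<Gamma> q = 2)\<^sup>*\<^sup>* b v})"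

definition core :: "('v, 'a) lgraph \<Rightarrow> 'v \<Rightarrow> ('v, 'a) lgraph" where
  "core \<Gamma> b =
     \<lparr>verts = verts \<Gamma> - tail_verts \<Gamma> b,
      edges = {(p, a, q) \<in> edges \<Gamma>. p \<notin> tail_verts \<Gamma> b \<and> q \<notin> tail_verts \<Gamma> b}\<rparr>"

definition tail_word :: "('v, 'a) lgraph \<Rightarrow> 'v \<Rightarrow> 'a letter list" where
  "tail_word \<Gamma> b =
     (if no_tail \<Gamma> then []
      else (ARG_MIN length w. \<exists>q\<in>verts (core \<Gamma> b). lpath \<Gamma> b w q))"

definition tail_end :: "('v, 'a) lgraph \<Rightarrow> 'v \<Rightarrow> 'v" where
  "tail_end \<Gamma> b =
     (if no_tail \<Gamma> then b
      else (THE q. q \<in> verts (core \<Gamma> b) \<and> lpath \<Gamma> b (tail_word \<Gamma> b) q))"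

definition path_lang :: "('v, 'a) lgraph \<Rightarrow> 'v \<Rightarrow> 'v \<Rightarrow> 'a letter list set" where
  "path_lang \<Gamma> b p = {w. \<exists>q. lpath (core \<Gamma> b) p w q}"

definition reduced_path_lang :: "('v, 'a) lgraph \<Rightarrow> 'v \<Rightarrow> 'v \<Rightarrow> 'a letter list set" where
  "reduced_path_lang \<Gamma> b p = {w \<in> path_lang \<Gamma> b p. reduced w}"

end

theory Submission
  imports Defs
begin

text \<open>
  Let \<open>T\<close> be the convex hull of the limit set of \<open>H\<close> in the Cayley tree of the free group, viewed as
  a set of reduced words. It consists of the reduced words that label a path from the base vertex to
  a core vertex of the Stallings graph, and it is the set of all words \<open>t @ u\<close>, where \<open>t\<close> is the tail word and
  \<open>u\<close> is a reduced word readable in the core from the end of the tail; \<open>t\<close> is its unique shortest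
  element. So \<open>T\<close> and the pair of tail and reduced language determine each other. The limit set does
  not change under finite-index extensions, so all of them stabilise \<open>T\<close>; conversely
  the stabiliser of \<open>T\<close> acts freely on \<open>T\<close>, which has finitely many \<open>H\<close>-orbits, one for each core
  vertex. Hence the maximum finite-index extension is the stabiliser of \<open>T\<close>, and its hull is again \<open>T\<close>.
\<close>

section \<open>Reduced words\<close>

definition winv :: "'a letter list \<Rightarrow> 'a letter list" where
  "winv w = map bar (rev w)"

lemma bar_inject [simp]: "bar x = bar y \<longleftrightarrow> x = y"
  by (metis bar_bar)

lemma winv_Nil [simp]: "winv [] = []"
  and winv_Cons [simp]: "winv (x # w) = winv w @ [bar x]"
  and winv_append [simp]: "winv (u @ v) = winv v @ winv u"
  and winv_winv [simp]: "winv (winv w) = w"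
  and winv_eq_Nil [simp]: "winv w = [] \<longleftrightarrow> w = []"
  and set_winv: "set (winv w) = bar ` set w"
  by (simp_all add: winv_def rev_map comp_def)

lemma hd_winv: "w \<noteq> [] \<Longrightarrow> hd (winv w) = bar (last w)"
  by (simp add: winv_def hd_map hd_rev)

lemma last_winv: "w \<noteq> [] \<Longrightarrow> last (winv w) = bar (hd w)"
  by (simp add: winv_def last_map last_rev)

lemma reduced_append:
  "reduced (u @ v) \<longleftrightarrow> reduced u \<and> reduced v \<and> (u = [] \<or> v = [] \<or> hd v \<noteq> bar (last u))"
  by (induction u) (auto simp: reduced_Cons hd_append)

lemma reduced_snoc: "reduced (u @ [x]) \<longleftrightarrow> reduced u \<and> (u = [] \<or> x \<noteq> bar (last u))"
  by (auto simp: reduced_append reduced_Cons)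

lemma reduced_winv [simp]: "reduced (winv w) \<longleftrightarrow> reduced w"
proof -
  have "reduced (winv w)" if "reduced w" for w :: "'a letter list"
    using that
  proof (induction w)
    case (Cons x w)
    then show ?case by (cases "w = []") (auto simp: reduced_Cons reduced_snoc last_winv)
  qed simp
  then show ?thesis by (metis winv_winv)
qed

text \<open>\<open>reduce\<close> folds from the right, so the effect of a letter at the right end
  is not immediate from its definition. Inductions along prefixes of a path need this form.\<close>

lemma reduce_snoc:
  assumes "reduced u"
  shows "reduce (u @ [x]) = (if u \<noteq> [] \<and> last u = bar x then butlast u else u @ [x])"
proof (cases "u \<noteq> [] \<and> last u = bar x")
  case True
  then obtain v where u: "u = v @ [bar x]" by (metis append_butlast_last_id)
  then have "reduce (u @ [x]) = reduce v"
    by (simp add: reduce_def)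
  also have "\<dots> = v" using assms u by (simp add: reduced_append reduce_reduced)
  finally show ?thesis using u by simp
next
  case False
  then have "reduced (u @ [x])" using assms by (auto simp: reduced_snoc)
  then show ?thesis using False by (auto simp: reduce_reduced)
qed

text \<open>Each letter of \<open>r\<close> removes at most one letter from the right end. As
  \<open>r\<close> is shorter than \<open>u\<close>, the first letter is never reached.\<close>

lemma reduce_append_short:
  assumes "reduced u" "length r < length u"
  shows "hd (reduce (u @ r)) = hd u \<and> length u \<le> length (reduce (u @ r)) + length r"
  using assms(2)
proof (induction r rule: rev_induct)
  case Nil
  then show ?case using assms by (simp add: reduce_reduced)
next
  case (snoc x r)
  let ?w = "reduce (u @ r)"
  have IH: "hd ?w = hd u" "length u \<le> length ?w + length r" using snoc by auto
  then have len: "length ?w \<ge> 2" using snoc.prems by simp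
  have eq: "reduce (u @ r @ [x]) = reduce (?w @ [x])"
    by (metis append.assoc reduce_append_left)
  have "?w \<noteq> []" "butlast ?w \<noteq> []" using len by (cases ?w rule: rev_cases; force)+
  then have "hd (butlast ?w) = hd ?w" by (metis append_butlast_last_id hd_append2)
  then show ?case
    using IH len \<open>?w \<noteq> []\<close> unfolding eq reduce_snoc[OF reduced_reduce] by (auto simp: hd_append)
qed

text \<open>Reading from left to right, each letter either lengthens or shortens the reduced word by
  one, so equality forces that no letter ever cancels.\<close>

lemma length_reduce: "length (reduce w) \<le> length w"
  and length_reduce_eq: "length (reduce w) = length w \<Longrightarrow> reduced w"
proof -
  have "length (reduce w) \<le> length w \<and> (length (reduce w) = length w \<longrightarrow> reduce w = w)"
  proof (induction w rule: rev_induct)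
    case (snoc x w)
    have "reduce (w @ [x]) = reduce (reduce w @ [x])" by (simp add: reduce_append_left)
    then show ?case using snoc unfolding reduce_snoc[OF reduced_reduce] by auto
  qed (simp add: reduce_reduced)
  then show "length (reduce w) \<le> length w" "length (reduce w) = length w \<Longrightarrow> reduced w"
    by (auto, metis reduced_reduce)
qed

lemma carrier_free_group: "w \<in> carrier (free_group A) \<longleftrightarrow> set w \<subseteq> letters A \<and> reduced w"
  and mult_free_group: "u \<otimes>\<^bsub>free_group A\<^esub> v = reduce (u @ v)"
  and one_free_group: "\<one>\<^bsub>free_group A\<^esub> = []"
  by (simp_all add: free_group_def)

lemma inv_free_group:
  assumes "w \<in> carrier (free_group A)"
  shows "inv\<^bsub>free_group A\<^esub> w = winv w"
proof (rule group.inv_equality[OF group_free_group])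
  show "winv w \<otimes>\<^bsub>free_group A\<^esub> w = \<one>\<^bsub>free_group A\<^esub>"
    by (simp add: mult_free_group one_free_group winv_def reduce_inverse)
  show "winv w \<in> carrier (free_group A)"
    using assms by (auto simp: carrier_free_group set_winv)
qed (fact assms)

lemma reduce_winv_append: "reduce (winv v @ reduce (v @ w)) = reduce w"
proof -
  have "reduce (winv v @ reduce (v @ w)) = reduce (reduce (winv v @ v) @ w)"
    by (simp add: reduce_append_left reduce_append_right)
  then show ?thesis by (simp add: winv_def reduce_inverse)
qed

section \<open>The convex hull of the limit set of a set of words\<close>

text \<open>Geometrically, \<open>v\<close> lies on a bi-infinite geodesic of the Cayley tree whose two ends are
  limits of elements of \<open>S\<close>.\<close>

definition hull :: "'a set \<Rightarrow> 'a letter list set \<Rightarrow> 'a letter list set" where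
  "hull A S = {v \<in> carrier (free_group A).
     \<forall>n. \<exists>s\<in>S. \<exists>s'\<in>S. n < length (inv\<^bsub>free_group A\<^esub> v \<otimes>\<^bsub>free_group A\<^esub> s) \<and>
       n < length (inv\<^bsub>free_group A\<^esub> v \<otimes>\<^bsub>free_group A\<^esub> s') \<and>
       hd (inv\<^bsub>free_group A\<^esub> v \<otimes>\<^bsub>free_group A\<^esub> s) \<noteq> hd (inv\<^bsub>free_group A\<^esub> v \<otimes>\<^bsub>free_group A\<^esub> s')}"

lemma hull_carrier: "hull A S \<subseteq> carrier (free_group A)"
  by (auto simp: hull_def)

lemma hull_mono: "S \<subseteq> S' \<Longrightarrow> hull A S \<subseteq> hull A S'"
  unfolding hull_def by (intro Collect_mono) (meson subsetD)

lemma hullE: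
  assumes "v \<in> hull A S"
  obtains s s' where "s \<in> S" "s' \<in> S" "n < length (reduce (winv v @ s))"
    "n < length (reduce (winv v @ s'))" "hd (reduce (winv v @ s)) \<noteq> hd (reduce (winv v @ s'))"
proof -
  have "v \<in> carrier (free_group A)" using assms hull_carrier by blast
  moreover from this assms have "\<exists>s\<in>S. \<exists>s'\<in>S. n < length (reduce (winv v @ s)) \<and>
      n < length (reduce (winv v @ s')) \<and> hd (reduce (winv v @ s)) \<noteq> hd (reduce (winv v @ s'))"
    unfolding hull_def by (simp add: inv_free_group mult_free_group)
  ultimately show ?thesis using that by blast
qed

text \<open>The two heads provided by the hull differ, so at least one of them is not
  \<open>x\<close>. Applied to the letter that would cancel at a junction, this yields a
  continuation without cancellation.\<close>

lemma hull_obtain_avoiding: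
  assumes "v \<in> hull A S"
  obtains s where "s \<in> S" "n < length (reduce (winv v @ s))" "hd (reduce (winv v @ s)) \<noteq> x"
proof -
  obtain s s' where "s \<in> S" "s' \<in> S" "n < length (reduce (winv v @ s))"
    "n < length (reduce (winv v @ s'))" "hd (reduce (winv v @ s)) \<noteq> hd (reduce (winv v @ s'))"
    by (rule hullE[OF assms])
  then show ?thesis using that by (cases "hd (reduce (winv v @ s)) = x") auto
qed

lemma hullI:
  assumes "v \<in> carrier (free_group A)"
    and "\<And>n. \<exists>s\<in>S. \<exists>s'\<in>S. n < length (reduce (winv v @ s)) \<and>
      n < length (reduce (winv v @ s')) \<and> hd (reduce (winv v @ s)) \<noteq> hd (reduce (winv v @ s'))"
  shows "v \<in> hull A S"
  using assms unfolding hull_def by (simp add: inv_free_group mult_free_group)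

text \<open>Membership of \<open>v\<close> depends on \<open>S\<close> only through the products of
  the inverse of \<open>v\<close> with elements of \<open>S\<close>, and translating both on the
  left leaves these products unchanged.\<close>

lemma hull_translate:
  assumes "g \<in> carrier (free_group A)" "S \<subseteq> carrier (free_group A)" "v \<in> hull A S"
  shows "g \<otimes>\<^bsub>free_group A\<^esub> v \<in> hull A (g <#\<^bsub>free_group A\<^esub> S)"
proof -
  interpret F: group "free_group A" by (rule group_free_group)
  have v: "v \<in> carrier (free_group A)" using assms hull_carrier by auto
  have "inv\<^bsub>free_group A\<^esub> (g \<otimes>\<^bsub>free_group A\<^esub> v) \<otimes>\<^bsub>free_group A\<^esub> (g \<otimes>\<^bsub>free_group A\<^esub> s)
      = inv\<^bsub>free_group A\<^esub> v \<otimes>\<^bsub>free_group A\<^esub> s" if "s \<in> S" for s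
  proof -
    have s: "s \<in> carrier (free_group A)" using that assms by auto
    have "inv\<^bsub>free_group A\<^esub> (g \<otimes>\<^bsub>free_group A\<^esub> v) \<otimes>\<^bsub>free_group A\<^esub> (g \<otimes>\<^bsub>free_group A\<^esub> s)
      = inv\<^bsub>free_group A\<^esub> v \<otimes>\<^bsub>free_group A\<^esub> (inv\<^bsub>free_group A\<^esub> g \<otimes>\<^bsub>free_group A\<^esub> (g \<otimes>\<^bsub>free_group A\<^esub> s))"
      using assms(1) v s by (simp add: F.inv_mult_group F.m_assoc)
    then show ?thesis using assms(1) v s by (simp add: F.m_assoc[symmetric])
  qed
  then show ?thesis
    using assms v unfolding hull_def by (simp add: l_coset_def)
qed

lemma hull_lcoset:
  assumes g: "g \<in> carrier (free_group A)" and S: "S \<subseteq> carrier (free_group A)"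
  shows "g <#\<^bsub>free_group A\<^esub> hull A S = hull A (g <#\<^bsub>free_group A\<^esub> S)"
proof -
  interpret F: group "free_group A" by (rule group_free_group)
  have sub: "g <#\<^bsub>free_group A\<^esub> hull A S \<subseteq> hull A (g <#\<^bsub>free_group A\<^esub> S)"
    if "g \<in> carrier (free_group A)" "S \<subseteq> carrier (free_group A)" for g S
    using hull_translate[OF that] by (auto simp: l_coset_def)
  \<comment> \<open>The reverse inclusion is the same fact for the inverse of \<open>g\<close>,
    applied to the translated set.\<close>
  have "v \<in> g <#\<^bsub>free_group A\<^esub> hull A S" if "v \<in> hull A (g <#\<^bsub>free_group A\<^esub> S)" for v
  proof -
    have "inv\<^bsub>free_group A\<^esub> g <#\<^bsub>free_group A\<^esub> (g <#\<^bsub>free_group A\<^esub> S) = S"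
      using g S by (simp add: F.lcos_m_assoc F.lcos_mult_one)
    then have "inv\<^bsub>free_group A\<^esub> g \<otimes>\<^bsub>free_group A\<^esub> v \<in> hull A S"
      using hull_translate[OF _ _ that, of "inv\<^bsub>free_group A\<^esub> g"] g S
      by (simp add: F.l_coset_subset_G)
    moreover have "v \<in> carrier (free_group A)" using that hull_carrier by blast
    then have "v = g \<otimes>\<^bsub>free_group A\<^esub> (inv\<^bsub>free_group A\<^esub> g \<otimes>\<^bsub>free_group A\<^esub> v)"
      using g by (simp add: F.m_assoc[symmetric])
    ultimately show ?thesis by (auto simp: l_coset_def)
  qed
  then show ?thesis using sub[OF g S] by blast
qed

text \<open>A right factor of bounded length changes a long geodesic from \<open>v\<close> only near
  its far end, so its first letter stays the same.\<close>

lemma hull_bounded_perturbation: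
  assumes "finite R" "S \<subseteq> carrier (free_group A)" "R \<subseteq> carrier (free_group A)"
    and "\<And>s. s \<in> S' \<Longrightarrow> \<exists>h\<in>S. \<exists>r\<in>R. s = h \<otimes>\<^bsub>free_group A\<^esub> r"
  shows "hull A S' \<subseteq> hull A S"
proof
  interpret F: group "free_group A" by (rule group_free_group)
  fix v assume v: "v \<in> hull A S'"
  obtain B where B: "\<And>r. r \<in> R \<Longrightarrow> length r \<le> B"
    using finite_nat_set_iff_bounded_le[of "length ` R"] assms(1) by auto
  \<comment> \<open>Passing from \<open>s\<close> back to \<open>h\<close> multiplies by the inverse
    of \<open>r\<close> and loses at most \<open>B\<close> letters, hence the demand for a length
    above \<open>n + B\<close>.\<close>
  have close: "\<exists>h\<in>S. n < length (reduce (winv v @ h)) \<and>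
      hd (reduce (winv v @ h)) = hd (reduce (winv v @ s))"
    if s: "s \<in> S'" "n + B < length (reduce (winv v @ s))" for s n
  proof -
    obtain h r where hr: "h \<in> S" "r \<in> R" "s = h \<otimes>\<^bsub>free_group A\<^esub> r" using assms(4) s by blast
    have carr: "h \<in> carrier (free_group A)" "r \<in> carrier (free_group A)"
      using hr assms by auto
    have "h = s \<otimes>\<^bsub>free_group A\<^esub> inv\<^bsub>free_group A\<^esub> r"
      using hr carr by (simp add: F.m_assoc)
    then have h: "h = reduce (s @ winv r)" using carr by (simp add: inv_free_group mult_free_group)
    have eq: "reduce (winv v @ h) = reduce (reduce (winv v @ s) @ winv r)"
      unfolding h by (simp add: reduce_append_right reduce_append_left)
    have "length (winv r) \<le> B" using B[OF hr(2)] by (simp add: winv_def)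
    then show ?thesis
      using reduce_append_short[OF reduced_reduce, of "winv r" "winv v @ s"] s hr(1)
      unfolding eq[symmetric] by force
  qed
  show "v \<in> hull A S"
  proof (rule hullI)
    show "v \<in> carrier (free_group A)" using v hull_carrier by auto
    fix n
    obtain s s' where "s \<in> S'" "s' \<in> S'" "n + B < length (reduce (winv v @ s))"
      "n + B < length (reduce (winv v @ s'))" "hd (reduce (winv v @ s)) \<noteq> hd (reduce (winv v @ s'))"
      using hullE[OF v, of "n + B"] by blast
    then show "\<exists>s\<in>S. \<exists>s'\<in>S. n < length (reduce (winv v @ s)) \<and>
      n < length (reduce (winv v @ s')) \<and> hd (reduce (winv v @ s)) \<noteq> hd (reduce (winv v @ s'))"
      using close by metis
  qed
qed

text \<open>Points of the hull appear as reductions of concatenations; this allows the concatenation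
  itself to be inverted instead.\<close>

lemma reduce_winv_reduce: "reduce (winv (reduce v) @ s) = reduce (winv v @ s)"
proof -
  have "reduce s = reduce (reduce (v @ winv v) @ s)"
    using reduce_inverse[of "winv v"] by (simp add: winv_def rev_map comp_def)
  also have "\<dots> = reduce (reduce v @ winv v @ s)" by (simp add: reduce_append_left)
  finally have "reduce (winv (reduce v) @ s) = reduce (winv (reduce v) @ reduce (reduce v @ winv v @ s))"
    by (metis reduce_append_right)
  then show ?thesis by (simp add: reduce_winv_append)
qed

text \<open>At an inner point of the segment, a long geodesic leaving \<open>v\<close> away from the
  segment, prolonged back along \<open>u1\<close>, gives one direction; a geodesic leaving the other
  end gives a second one.\<close>

lemma hull_convex:
  assumes v: "v \<in> hull A S" and w: "reduce (v @ u1 @ u2) \<in> hull A S"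
    and u: "reduced (u1 @ u2)" "set u1 \<subseteq> letters A"
  shows "reduce (v @ u1) \<in> hull A S"
proof (cases "u1 = [] \<or> u2 = []")
  case True
  then show ?thesis
    using v w hull_carrier[of A S] by (auto simp: carrier_free_group reduce_reduced)
next
  case False
  show ?thesis
  proof (rule hullI)
    have "v \<in> carrier (free_group A)" using v hull_carrier by blast
    then show "reduce (v @ u1) \<in> carrier (free_group A)"
      using u(2) set_reduce[of "v @ u1"] by (auto simp: carrier_free_group reduced_reduce)
    fix n
    have from_p: "reduce (winv (reduce (v @ u1)) @ s) = reduce (winv u1 @ reduce (winv v @ s))" for s
      by (simp add: reduce_winv_reduce reduce_append_right)
    obtain s where s: "s \<in> S" "n < length (reduce (winv v @ s))" "hd (reduce (winv v @ s)) \<noteq> hd u1"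
      using hull_obtain_avoiding[OF v] by metis
    let ?d = "reduce (winv v @ s)"
    have "reduced (winv u1 @ ?d)"
      using s False u by (auto simp: reduced_append reduced_reduce last_winv)
    then have 1: "reduce (winv (reduce (v @ u1)) @ s) = winv u1 @ ?d"
      unfolding from_p by (simp add: reduce_reduced)
    \<comment> \<open>Avoiding \<open>bar (last u2)\<close> keeps the geodesic from running back
      into the segment.\<close>
    obtain s' where s': "s' \<in> S" "n < length (reduce (winv (reduce (v @ u1 @ u2)) @ s'))"
        "hd (reduce (winv (reduce (v @ u1 @ u2)) @ s')) \<noteq> bar (last u2)"
      using hull_obtain_avoiding[OF w] by metis
    let ?d' = "reduce (winv (reduce (v @ u1 @ u2)) @ s')"
    have "?d' = reduce (winv u2 @ reduce (winv u1 @ winv v @ s'))"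
      by (simp add: reduce_winv_reduce reduce_append_right)
    then have "reduce (u2 @ ?d') = reduce (winv u1 @ winv v @ s')"
      using reduce_winv_append[of "winv u2"] by (simp add: reduce_reduced reduced_reduce)
    moreover have "reduced (u2 @ ?d')"
      using s' u by (auto simp: reduced_append reduced_reduce)
    ultimately have 2: "reduce (winv (reduce (v @ u1)) @ s') = u2 @ ?d'"
      unfolding from_p by (metis reduce_append_right reduce_reduced)
    \<comment> \<open>The two directions begin with \<open>bar (last u1)\<close> and
      \<open>hd u2\<close>, which differ because \<open>u1 @ u2\<close> is reduced.\<close>
    have "hd (winv u1 @ ?d) \<noteq> hd (u2 @ ?d')"
      using False u by (auto simp: reduced_append hd_winv)
    then show "\<exists>s\<in>S. \<exists>s'\<in>S. n < length (reduce (winv (reduce (v @ u1)) @ s)) \<and>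
      n < length (reduce (winv (reduce (v @ u1)) @ s')) \<and>
      hd (reduce (winv (reduce (v @ u1)) @ s)) \<noteq> hd (reduce (winv (reduce (v @ u1)) @ s'))"
      using s s' 1 2 by (intro bexI[of _ s] bexI[of _ s']) auto
  qed
qed

section \<open>Paths in folded graphs\<close>

text \<open>Only the end-point condition and determinism in both directions are kept from the
  Stallings graph, so that the same facts are available in the core.\<close>

locale folded_graph =
  fixes \<Gamma> :: "('v, 'a) lgraph"
  assumes edges_verts: "(p, a, q) \<in> edges \<Gamma> \<Longrightarrow> p \<in> verts \<Gamma> \<and> q \<in> verts \<Gamma>"
    and det_out: "(p, a, q) \<in> edges \<Gamma> \<Longrightarrow> (p, a, q') \<in> edges \<Gamma> \<Longrightarrow> q = q'"
    and det_in: "(p, a, q) \<in> edges \<Gamma> \<Longrightarrow> (p', a, q) \<in> edges \<Gamma> \<Longrightarrow> p = p'"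
begin

lemma lstep_verts: "lstep \<Gamma> p x q \<Longrightarrow> p \<in> verts \<Gamma> \<and> q \<in> verts \<Gamma>"
  by (cases x) (auto dest: edges_verts)

lemma lstep_det: "lstep \<Gamma> p x q \<Longrightarrow> lstep \<Gamma> p x q' \<Longrightarrow> q = q'"
  by (cases x) (auto dest: det_out det_in)

lemma lstep_bar: "lstep \<Gamma> p (bar x) q \<longleftrightarrow> lstep \<Gamma> q x p"
  by (cases x) auto

lemma lpath_verts: "lpath \<Gamma> p w q \<Longrightarrow> p \<in> verts \<Gamma> \<and> q \<in> verts \<Gamma>"
  by (induction w arbitrary: p) auto

lemma lpath_append: "lpath \<Gamma> p (u @ v) q \<longleftrightarrow> (\<exists>r. lpath \<Gamma> p u r \<and> lpath \<Gamma> r v q)"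
  by (induction u arbitrary: p) (auto dest: lpath_verts)

lemma lpath_singleton: "lpath \<Gamma> p [x] q \<longleftrightarrow> lstep \<Gamma> p x q"
  by (auto dest: lstep_verts)

lemma lpath_snoc: "lpath \<Gamma> p (u @ [x]) q \<longleftrightarrow> (\<exists>r. lpath \<Gamma> p u r \<and> lstep \<Gamma> r x q)"
  by (simp only: lpath_append lpath_singleton)

lemma lpath_det: "lpath \<Gamma> p w q \<Longrightarrow> lpath \<Gamma> p w q' \<Longrightarrow> q = q'"
  by (induction w arbitrary: p) (auto dest: lstep_det)

lemma lpath_winv:
  assumes "lpath \<Gamma> p w q" shows "lpath \<Gamma> q (winv w) p"
  using assms
proof (induction w arbitrary: p)
  case (Cons x w)
  then obtain r where "lstep \<Gamma> p x r" "lpath \<Gamma> r w q" by auto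
  then show ?case using Cons.IH by (auto simp: lpath_snoc lstep_bar)
qed auto

text \<open>In a folded graph reading \<open>x\<close> and then \<open>bar x\<close> leads back to
  the starting vertex, so cancellation does not change the end of a path.\<close>

lemma lpath_reduce:
  assumes "lpath \<Gamma> p w q" shows "lpath \<Gamma> p (reduce w) q"
  using assms
proof (induction w arbitrary: p)
  case (Cons x w)
  then obtain r where r: "lstep \<Gamma> p x r" "lpath \<Gamma> r (reduce w) q" by auto
  have "lpath \<Gamma> p (cancel_cons x (reduce w)) q"
  proof (cases "reduce w")
    case Nil
    then show ?thesis using r lstep_verts by auto
  next
    case (Cons y v)
    show ?thesis
    proof (cases "y = bar x")
      case True
      then obtain p' where "lstep \<Gamma> r (bar x) p'" "lpath \<Gamma> p' v q" using r Cons by auto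
      moreover have "p' = p" using calculation(1) r(1) by (auto simp: lstep_bar intro: lstep_det[of r "bar x"])
      ultimately show ?thesis using Cons True by simp
    next
      case False
      then show ?thesis using r lstep_verts Cons by auto
    qed
  qed
  then show ?case by (simp add: reduce_def)
qed (simp add: reduce_def)

text \<open>This recovers all readable words from the reduced ones. If \<open>w\<close> ends at
  \<open>q\<close>, so does its reduction; a further letter either cancels, and then runs back along
  the last edge into \<open>q\<close>, or is read at \<open>q\<close> by the longer reduced
  word.\<close>

lemma readable_iff_reduced_prefixes_readable:
  "(\<exists>q. lpath \<Gamma> p w q) \<longleftrightarrow> (\<forall>u v. w = u @ v \<longrightarrow> (\<exists>q. lpath \<Gamma> p (reduce u) q))"
proof
  assume "\<exists>q. lpath \<Gamma> p w q"
  then show "\<forall>u v. w = u @ v \<longrightarrow> (\<exists>q. lpath \<Gamma> p (reduce u) q)"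
    using lpath_reduce by (fastforce simp: lpath_append)
next
  assume "\<forall>u v. w = u @ v \<longrightarrow> (\<exists>q. lpath \<Gamma> p (reduce u) q)"
  then show "\<exists>q. lpath \<Gamma> p w q"
  proof (induction w rule: rev_induct)
    case Nil
    then show ?case by (simp add: reduce_def)
  next
    case (snoc x w)
    have "\<exists>q. lpath \<Gamma> p w q" using snoc.prems by (intro snoc.IH) auto
    then obtain q where q: "lpath \<Gamma> p w q" by blast
    let ?u = "reduce w"
    have u: "lpath \<Gamma> p ?u q" using q by (rule lpath_reduce)
    have "\<exists>r. lpath \<Gamma> p (reduce (w @ [x])) r" using snoc.prems by (metis append_Nil2)
    then obtain r where r: "lpath \<Gamma> p (reduce (?u @ [x])) r" by (auto simp: reduce_append_left)
    show ?case
    proof (cases "?u \<noteq> [] \<and> last ?u = bar x")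
      case True
      then have "?u = butlast ?u @ [bar x]" by (metis append_butlast_last_id)
      then obtain r' where "lstep \<Gamma> r' (bar x) q" using u lpath_snoc by metis
      then have "lstep \<Gamma> q x r'" by (simp add: lstep_bar)
      then show ?thesis using q by (auto simp: lpath_snoc)
    next
      case False
      then have "lpath \<Gamma> p (?u @ [x]) r"
        using r by (simp only: reduce_snoc[OF reduced_reduce] if_False)
      then obtain q' where "lpath \<Gamma> p ?u q'" "lstep \<Gamma> q' x r" by (auto simp: lpath_snoc)
      moreover have "q' = q" using calculation(1) u by (rule lpath_det)
      ultimately show ?thesis using q by (auto simp: lpath_snoc)
    qed
  qed
qed

section \<open>Vertex degrees counted by readable letters\<close>

definition out_letters :: "'v \<Rightarrow> 'a letter set" where
  "out_letters p = {x. \<exists>q. lstep \<Gamma> p x q}"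

lemma out_letters_eq:
  "out_letters v = Bar ` (fst \<circ> snd) ` {(p, a, q) \<in> edges \<Gamma>. q = v} \<union>
     Pos ` (fst \<circ> snd) ` {(p, a, q) \<in> edges \<Gamma>. p = v}"
proof -
  have "x \<in> out_letters v \<longleftrightarrow> x \<in> Bar ` (fst \<circ> snd) ` {(p, a, q) \<in> edges \<Gamma>. q = v} \<union>
     Pos ` (fst \<circ> snd) ` {(p, a, q) \<in> edges \<Gamma>. p = v}" for x
    by (cases x) (force simp: out_letters_def image_iff)+
  then show ?thesis by blast
qed

lemma finite_out_letters: "finite (edges \<Gamma>) \<Longrightarrow> finite (out_letters v)"
  unfolding out_letters_eq by (intro finite_UnI finite_imageI) (auto elim: rev_finite_subset)

text \<open>Foldedness makes the edges into a vertex, and those out of it, correspond bijectively to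
  their labels, and the sign separates the two kinds. A loop supplies both letters, in agreement
  with the degree convention.\<close>

lemma degree_eq_card_out_letters:
  assumes "finite (edges \<Gamma>)"
  shows "degree \<Gamma> v = card (out_letters v)"
proof -
  let ?I = "{(p, a, q) \<in> edges \<Gamma>. q = v}" and ?O = "{(p, a, q) \<in> edges \<Gamma>. p = v}"
  have fin: "finite ?I" "finite ?O" using assms by (auto elim: rev_finite_subset)
  have "inj_on (fst \<circ> snd) ?I" "inj_on (fst \<circ> snd) ?O"
    using det_in det_out by (auto simp: inj_on_def)
  from this[THEN card_image] have "card ((fst \<circ> snd) ` ?I) = card ?I" "card ((fst \<circ> snd) ` ?O) = card ?O"
    by blast+
  moreover have "card (out_letters v) = card ((fst \<circ> snd) ` ?I) + card ((fst \<circ> snd) ` ?O)"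
    unfolding out_letters_eq using fin
    by (subst card_Un_disjoint) (auto simp: card_image inj_on_def)
  ultimately show ?thesis by (simp only: degree_def)
qed

text \<open>Handshake lemma: grouping the edges by source, and again by target, counts each of them
  once each time.\<close>

lemma sum_degree:
  assumes "finite (verts \<Gamma>)" "finite (edges \<Gamma>)"
  shows "(\<Sum>v\<in>verts \<Gamma>. degree \<Gamma> v) = 2 * card (edges \<Gamma>)"
proof -
  have "(\<Sum>v\<in>verts \<Gamma>. card {e \<in> edges \<Gamma>. f e = v}) = card (edges \<Gamma>)"
    if "f ` edges \<Gamma> \<subseteq> verts \<Gamma>" for f
    using sum.group[OF assms(2,1) that, of "\<lambda>_. 1::nat"] by simp
  from this[of fst] this[of "snd \<circ> snd"]
  have "(\<Sum>v\<in>verts \<Gamma>. card {e \<in> edges \<Gamma>. fst e = v}) = card (edges \<Gamma>)"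
    "(\<Sum>v\<in>verts \<Gamma>. card {e \<in> edges \<Gamma>. snd (snd e) = v}) = card (edges \<Gamma>)"
    using edges_verts by force+
  moreover have "degree \<Gamma> v = card {e \<in> edges \<Gamma>. snd (snd e) = v} + card {e \<in> edges \<Gamma>. fst e = v}"
    for v unfolding degree_def by (intro arg_cong2[where f = "(+)"] arg_cong[where f = card]) auto
  ultimately show ?thesis by (simp add: sum.distrib)
qed

lemma folded_graph_core: "folded_graph (core \<Gamma> b)"
  by unfold_locales (auto simp: core_def dest: edges_verts det_out det_in)

lemma lstep_core:
  "lstep (core \<Gamma> b) p x q \<longleftrightarrow> lstep \<Gamma> p x q \<and> p \<in> verts (core \<Gamma> b) \<and> q \<in> verts (core \<Gamma> b)"
  by (cases x) (auto simp: core_def dest: edges_verts)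

lemma verts_core: "verts (core \<Gamma> b) = verts \<Gamma> - tail_verts \<Gamma> b"
  by (simp add: core_def)

lemma lpath_core: "lpath (core \<Gamma> b) p w q \<Longrightarrow> lpath \<Gamma> p w q"
  by (induction w arbitrary: p) (auto simp: lstep_core verts_core)

end

section \<open>The tail of a Stallings graph\<close>

text \<open>The closure in \<open>tail_verts\<close> may backtrack. Recording a reduced word
  excludes this and, when there is a tail, leaves no choice for the next letter.\<close>

inductive tail_path :: "('v, 'a) lgraph \<Rightarrow> 'v \<Rightarrow> 'a letter list \<Rightarrow> 'v \<Rightarrow> bool" for \<Gamma> b where
  tail_path_Nil: "tail_path \<Gamma> b [] b"
| tail_path_snoc: "tail_path \<Gamma> b u p \<Longrightarrow> lstep \<Gamma> p x q \<Longrightarrow> degree \<Gamma> q = 2 \<Longrightarrow>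
    reduced (u @ [x]) \<Longrightarrow> tail_path \<Gamma> b (u @ [x]) q"

locale stallings =
  fixes A :: "'a set" and H :: "'a letter list set" and \<Gamma> :: "('v, 'a) lgraph" and b :: 'v
  assumes stallings: "stallings_graph A H \<Gamma> b"
    and subgroup: "subgroup H (free_group A)"
    and nontrivial: "H \<noteq> {\<one>\<^bsub>free_group A\<^esub>}"
begin

lemma finite_verts: "finite (verts \<Gamma>)" and b_vert: "b \<in> verts \<Gamma>"
  and edges_subset: "edges \<Gamma> \<subseteq> verts \<Gamma> \<times> A \<times> verts \<Gamma>" and finite_edges: "finite (edges \<Gamma>)"
  and connected: "p \<in> verts \<Gamma> \<Longrightarrow> q \<in> verts \<Gamma> \<Longrightarrow> \<exists>w. lpath \<Gamma> p w q"
  and degree_ge_2: "v \<in> verts \<Gamma> \<Longrightarrow> v \<noteq> b \<Longrightarrow> degree \<Gamma> v \<ge> 2"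
  and mem_iff: "set w \<subseteq> letters A \<Longrightarrow> reduced w \<Longrightarrow> w \<in> H \<longleftrightarrow> lpath \<Gamma> b w b"
  using stallings unfolding stallings_graph_def by blast+

sublocale folded_graph \<Gamma>
  using stallings by unfold_locales (unfold stallings_graph_def, blast+)

sublocale core: folded_graph "core \<Gamma> b"
  by (rule folded_graph_core)

lemma H_carrier: "H \<subseteq> carrier (free_group A)"
  using subgroup by (rule subgroup.subset)

lemma lpath_letters: "lpath \<Gamma> p w q \<Longrightarrow> set w \<subseteq> letters A"
proof (induction w arbitrary: p)
  case (Cons x w)
  then show ?case using edges_subset by (cases x) (auto simp: letters_def)
qed simp

lemma lpath_if_mem: "s \<in> H \<Longrightarrow> lpath \<Gamma> b s b"
  using mem_iff H_carrier by (auto simp: carrier_free_group)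

lemma mem_if_lpath: "lpath \<Gamma> b w b \<Longrightarrow> reduce w \<in> H"
  using lpath_reduce[of b w b] lpath_letters reduced_reduce by (subst mem_iff) auto

lemma degree_out: "degree \<Gamma> p = card (out_letters p)"
  using finite_edges by (rule degree_eq_card_out_letters)

lemma finite_out: "finite (out_letters p)"
  using finite_edges by (rule finite_out_letters)

lemma tail_path_lpath: "tail_path \<Gamma> b u p \<Longrightarrow> lpath \<Gamma> b u p"
  by (induction rule: tail_path.induct) (auto simp: b_vert lpath_snoc)

lemma tail_path_reduced: "tail_path \<Gamma> b u p \<Longrightarrow> reduced u"
  by (induction rule: tail_path.induct) auto

lemma tail_path_end: "tail_path \<Gamma> b u p \<Longrightarrow> if u = [] then p = b else degree \<Gamma> p = 2"
  by (induction rule: tail_path.induct) auto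

lemma tail_path_prefix: "tail_path \<Gamma> b w q \<Longrightarrow> w = u @ v \<Longrightarrow> \<exists>p. tail_path \<Gamma> b u p"
proof (induction arbitrary: v rule: tail_path.induct)
  case (tail_path_snoc w p x q)
  then show ?case by (cases v rule: rev_cases) (auto intro: tail_path.tail_path_snoc)
qed (auto intro: tail_path.intros)

text \<open>A nonempty element of \<open>H\<close> labels a loop at \<open>b\<close>, whose first
  letter leaves \<open>b\<close>. With the degree bound at the other vertices this pins the degree
  of \<open>b\<close> down to 1 when there is a tail.\<close>

lemma b_out: "degree \<Gamma> b \<ge> 1"
proof -
  have "[] \<in> H" using subgroup.one_closed[OF subgroup] by (simp add: one_free_group)
  then obtain s where "s \<in> H" "s \<noteq> []" using nontrivial by (auto simp: one_free_group)
  then have "hd s \<in> out_letters b"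
    using lpath_if_mem[of s] by (cases s) (auto simp: out_letters_def)
  then show ?thesis using finite_out[of b] by (auto simp: degree_out card_gt_0_iff Suc_le_eq)
qed

lemma no_tail_core: "no_tail \<Gamma> \<Longrightarrow> core \<Gamma> b = \<Gamma>"
  by (cases \<Gamma>) (auto simp: core_def tail_verts_def)

lemma degree_b: "\<not> no_tail \<Gamma> \<Longrightarrow> degree \<Gamma> b = 1"
  using b_out degree_ge_2 unfolding no_tail_def by force

text \<open>Where a step of the closure cancels the last letter of \<open>u\<close>, determinism
  makes it return to the preceding vertex of the tail path, so reduced paths reach the same
  vertices.\<close>

lemma tail_verts_iff: "\<not> no_tail \<Gamma> \<Longrightarrow> p \<in> tail_verts \<Gamma> b \<longleftrightarrow> (\<exists>u. tail_path \<Gamma> b u p)"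
proof
  let ?R = "\<lambda>p q. (\<exists>x. lstep \<Gamma> p x q) \<and> degree \<Gamma> q = 2"
  assume nt: "\<not> no_tail \<Gamma>"
  {
    assume "p \<in> tail_verts \<Gamma> b"
    then have "?R\<^sup>*\<^sup>* b p" using nt by (simp add: tail_verts_def)
    then show "\<exists>u. tail_path \<Gamma> b u p"
    proof (induction rule: rtranclp_induct)
      case base
      show ?case by (rule exI[of _ "[]"], rule tail_path_Nil)
    next
      case (step p q)
      then obtain x u where x: "lstep \<Gamma> p x q" "degree \<Gamma> q = 2" and u: "tail_path \<Gamma> b u p" by blast
      show ?case
      proof (cases "reduced (u @ [x])")
        case True
        then show ?thesis using u x tail_path_snoc by metis
      next
        case False
        then have "u \<noteq> []" "last u = bar x"
          using tail_path_reduced[OF u] by (auto simp: reduced_snoc)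
        from u this show ?thesis
        proof cases
          case (tail_path_snoc u' p' y)
          then have "lstep \<Gamma> p x p'" using \<open>last u = bar x\<close> by (simp add: lstep_bar)
          then show ?thesis using x tail_path_snoc lstep_det by blast
        qed simp
      qed
    qed
  }
  assume "\<exists>u. tail_path \<Gamma> b u p"
  then obtain u where "tail_path \<Gamma> b u p" by blast
  then have "?R\<^sup>*\<^sup>* b p"
    by (induction rule: tail_path.induct) (auto intro: rtranclp.rtrancl_into_rtrancl)
  then show "p \<in> tail_verts \<Gamma> b" using nt by (simp add: tail_verts_def)
qed

lemma bar_last_out:
  assumes "lpath \<Gamma> p u q" "u \<noteq> []"
  shows "bar (last u) \<in> out_letters q"
  using assms by (cases u rule: rev_cases) (auto simp: lpath_snoc out_letters_def lstep_bar)

text \<open>The base vertex has degree 1, and any later vertex of a tail path has degree 2 with one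
  letter leading back, so a single letter remains.\<close>

lemma tail_path_forced:
  assumes "\<not> no_tail \<Gamma>" "tail_path \<Gamma> b u p" "x \<in> out_letters p" "y \<in> out_letters p"
    and "reduced (u @ [x])" "reduced (u @ [y])"
  shows "x = y"
proof (cases "u = []")
  case True
  then have "card (out_letters p) = 1"
    using tail_path_end[OF assms(2)] degree_b assms(1) by (simp add: degree_out)
  then show ?thesis using assms(3,4) by (auto simp: card_1_singleton_iff)
next
  case False
  then have "card (out_letters p) = 2"
    using tail_path_end[OF assms(2)] by (simp add: degree_out)
  moreover have "bar (last u) \<in> out_letters p" using assms False tail_path_lpath bar_last_out by blast
  moreover have "x \<noteq> bar (last u)" "y \<noteq> bar (last u)" using assms False by (auto simp: reduced_snoc)
  ultimately show ?thesis using assms(3,4) by (auto simp: card_2_iff)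
qed

text \<open>By induction on the prefixes of \<open>w\<close>: without backtracking the tail leaves
  no choice of the next letter.\<close>

lemma tail_path_unique:
  assumes "\<not> no_tail \<Gamma>" "tail_path \<Gamma> b u p" "lpath \<Gamma> b w q" "reduced w" "length w \<le> length u"
  shows "w = take (length w) u"
  using assms(3-5)
proof (induction w arbitrary: q rule: rev_induct)
  case (snoc x w)
  then obtain r where r: "lpath \<Gamma> b w r" "lstep \<Gamma> r x q" by (auto simp: lpath_snoc)
  have w: "w = take (length w) u" using snoc r(1) by (auto simp: reduced_snoc)
  \<comment> \<open>\<open>y\<close> is the letter of \<open>u\<close> that competes with
    \<open>x\<close> after the common prefix \<open>w\<close>.\<close>
  then obtain y v where u: "u = w @ y # v"
    using snoc.prems(3) by (metis append_take_drop_id id_take_nth_drop length_append_singleton Suc_le_eq)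
  obtain r' where "tail_path \<Gamma> b w r'" using tail_path_prefix assms(2) u by blast
  moreover have "r' = r" using calculation r(1) tail_path_lpath lpath_det by blast
  ultimately have tp: "tail_path \<Gamma> b w r" by simp
  have "lpath \<Gamma> b (w @ [y] @ v) p" using assms(2) tail_path_lpath u by simp
  then obtain r' where r': "lpath \<Gamma> b w r'" "lpath \<Gamma> r' ([y] @ v) p" unfolding lpath_append by blast
  have "r' = r" using r'(1) r(1) by (rule lpath_det)
  then have "y \<in> out_letters r"
    using r'(2) by (auto simp: out_letters_def)
  moreover have "reduced (w @ [y])" 
    using tail_path_reduced[OF assms(2)] reduced_append[of "w @ [y]" v] u by simp
  moreover have "x \<in> out_letters r" using r by (auto simp: out_letters_def)
  ultimately have "x = y" using tail_path_forced[OF assms(1) tp] snoc.prems by blast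
  then show ?case using u by simp
qed simp

text \<open>A reduced path that turns back along the tail can only continue towards
  \<open>b\<close>, where degree 1 stops it.\<close>

lemma tail_path_stuck:
  assumes "\<not> no_tail \<Gamma>" "tail_path \<Gamma> b u p" "u \<noteq> []"
    and "lpath \<Gamma> p w q" "reduced w" "w \<noteq> []" "hd w = bar (last u)"
  shows "length w \<le> length u"
  using assms(2-)
proof (induction arbitrary: w rule: tail_path.induct)
  case (tail_path_snoc u p x q')
  obtain w' where w: "w = bar x # w'" using tail_path_snoc.prems by (cases w) auto
  have "lpath \<Gamma> p w' q"
    using tail_path_snoc.prems(2) tail_path_snoc.hyps(2) w lstep_det[of q' "bar x"]
    by (auto simp: lstep_bar)
  moreover have "reduced w'" using tail_path_snoc.prems w by (simp add: reduced_Cons)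
  moreover have "u \<noteq> [] \<and> hd w' = bar (last u)" if "w' \<noteq> []"
  proof -
    have "hd w' \<in> out_letters p"
      using calculation(1) that by (cases w') (auto simp: out_letters_def)
    moreover have "x \<in> out_letters p" using tail_path_snoc.hyps by (auto simp: out_letters_def)
    moreover have "hd w' \<noteq> x" using tail_path_snoc.prems(3) w that by (auto simp: reduced_Cons)
    ultimately have "\<not> reduced (u @ [hd w'])"
      using tail_path_forced[OF assms(1) tail_path_snoc.hyps(1)] tail_path_snoc.hyps by blast
    then show ?thesis using tail_path_reduced tail_path_snoc.hyps(1) by (auto simp: reduced_snoc)
  qed
  ultimately have "length w' \<le> length u" using tail_path_snoc.IH by (cases "w' = []") auto
  then show ?case using w by simp
qed simp

text \<open>A reduced path longer than the tail path to \<open>p\<close> cannot run towards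
  \<open>b\<close>, so it starts with the single letter leading away. This excludes tail vertices
  from the hull.\<close>

lemma tail_long_paths_agree:
  assumes p: "p \<in> tail_verts \<Gamma> b"
  shows "\<exists>n. \<forall>w w' q q'. reduced w \<longrightarrow> reduced w' \<longrightarrow> lpath \<Gamma> p w q \<longrightarrow> lpath \<Gamma> p w' q' \<longrightarrow>
    n < length w \<longrightarrow> n < length w' \<longrightarrow> hd w = hd w'"
proof -
  have nt: "\<not> no_tail \<Gamma>" using p by (auto simp: tail_verts_def)
  obtain u where u: "tail_path \<Gamma> b u p" using tail_verts_iff nt p by blast
  have *: "hd w \<in> out_letters p \<and> reduced (u @ [hd w])"
    if w: "reduced w" "lpath \<Gamma> p w q" "length u < length w" for w q
  proof
    show "hd w \<in> out_letters p" using w by (cases w) (auto simp: out_letters_def)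
    have "w \<noteq> []" using w(3) by auto
    then show "reduced (u @ [hd w])"
      using tail_path_reduced[OF u] tail_path_stuck[OF nt u _ w(2,1)] w(3)
      unfolding reduced_snoc by linarith
  qed
  show ?thesis using * tail_path_forced[OF nt u] by (intro exI[of _ "length u"]) metis
qed

section \<open>Nonemptiness and minimum degree of the core\<close>

lemma core_nonempty: "verts (core \<Gamma> b) \<noteq> {}"
proof (cases "no_tail \<Gamma>")
  case True
  then show ?thesis using b_vert no_tail_core by auto
next
  case False
  show ?thesis
  proof
    assume "verts (core \<Gamma> b) = {}"
    then have "degree \<Gamma> v = 2" if "v \<in> verts \<Gamma> - {b}" for v
    proof -
      have "v \<in> tail_verts \<Gamma> b" using that \<open>verts (core \<Gamma> b) = {}\<close> by (auto simp: verts_core)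
      then obtain u where u: "tail_path \<Gamma> b u v"
        using tail_verts_iff[OF False] by blast
      then have "u \<noteq> []" using that tail_path_lpath[OF u] by auto
      then show ?thesis using tail_path_end[OF u] by simp
    qed
    then have "(\<Sum>v\<in>verts \<Gamma> - {b}. degree \<Gamma> v) = (\<Sum>v\<in>verts \<Gamma> - {b}. 2)" by (intro sum.cong) auto
    then have "(\<Sum>v\<in>verts \<Gamma>. degree \<Gamma> v) = 1 + 2 * card (verts \<Gamma> - {b})"
      using b_vert finite_verts degree_b[OF False] by (simp add: sum.remove)
    \<comment> \<open>an odd degree sum contradicts the handshake lemma\<close>
    then show False using sum_degree[OF finite_verts finite_edges] by presburger
  qed
qed

text \<open>At most one letter is lost with the tail, and where one is lost the original degree was
  at least 3, since with degree 2 the vertex would have belonged to the tail.\<close>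

lemma core_out_letters_card: "p \<in> verts (core \<Gamma> b) \<Longrightarrow> card (core.out_letters p) \<ge> 2"
proof (cases "no_tail \<Gamma>")
  case True
  assume "p \<in> verts (core \<Gamma> b)"
  moreover have "core.out_letters p = out_letters p" by (simp only: no_tail_core[OF True])
  ultimately show ?thesis using True by (simp add: verts_core no_tail_def degree_out)
next
  case False
  assume p: "p \<in> verts (core \<Gamma> b)"
  have "b \<in> tail_verts \<Gamma> b" unfolding tail_verts_iff[OF False] by (rule exI, rule tail_path_Nil)
  then have deg: "degree \<Gamma> p \<ge> 2" using p degree_ge_2 by (auto simp: verts_core)
  have no_path: "\<not> tail_path \<Gamma> b u p" for u
    using tail_verts_iff[OF False] p by (auto simp: verts_core)
  define E where "E = {x. \<exists>q. lstep \<Gamma> p x q \<and> q \<in> tail_verts \<Gamma> b}"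
  have out: "out_letters p = core.out_letters p \<union> E"
    using p lstep_verts by (auto simp: out_letters_def core.out_letters_def E_def lstep_core verts_core)
  \<comment> \<open>Arriving at \<open>p\<close> from the tail is never a backtracking step, as that
    would make \<open>p\<close> the preceding vertex of a tail path.\<close>
  have reach: "\<exists>u q. tail_path \<Gamma> b u q \<and> lstep \<Gamma> q (bar x) p \<and> reduced (u @ [bar x])"
    if "x \<in> E" for x
  proof -
    obtain q u where q: "lstep \<Gamma> p x q" "tail_path \<Gamma> b u q"
      using \<open>x \<in> E\<close> tail_verts_iff[OF False] by (auto simp: E_def)
    have "reduced (u @ [bar x])"
    proof (rule ccontr)
      assume "\<not> reduced (u @ [bar x])"
      then have "u \<noteq> []" "last u = x" using tail_path_reduced[OF q(2)] by (auto simp: reduced_snoc)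
      with q(2) show False
      proof cases
        case (tail_path_snoc u' p' y)
        then have "lstep \<Gamma> q (bar x) p'" using \<open>last u = x\<close> by (simp add: lstep_bar)
        moreover have "lstep \<Gamma> q (bar x) p" using q(1) by (simp add: lstep_bar)
        ultimately have "p' = p" using lstep_det by blast
        then show ?thesis using no_path tail_path_snoc by blast
      qed simp
    qed
    then show ?thesis using q by (auto simp: lstep_bar)
  qed
  have one: "x = y" if xy: "x \<in> E" "y \<in> E" for x y
  proof -
    obtain u q where u: "tail_path \<Gamma> b u q" "lstep \<Gamma> q (bar x) p" "reduced (u @ [bar x])"
      using reach[OF xy(1)] by blast
    obtain v r where v: "tail_path \<Gamma> b v r" "lstep \<Gamma> r (bar y) p" "reduced (v @ [bar y])"
      using reach[OF xy(2)] by blast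
    \<comment> \<open>A shorter tail path, prolonged to the core vertex \<open>p\<close>, would be a
      prefix of the longer one and put \<open>p\<close> into the tail.\<close>
    have not_less: "\<not> length u < length v"
      if u: "tail_path \<Gamma> b u q" "lstep \<Gamma> q (bar x) p" "reduced (u @ [bar x])"
        and v: "tail_path \<Gamma> b v r" for u v q r x
    proof
      assume "length u < length v"
      moreover have ux: "lpath \<Gamma> b (u @ [bar x]) p" using u tail_path_lpath by (auto simp: lpath_snoc)
      ultimately have "u @ [bar x] = take (length (u @ [bar x])) v"
        by (intro tail_path_unique[OF False v ux u(3)]) simp
      then have "v = (u @ [bar x]) @ drop (length (u @ [bar x])) v" by (metis append_take_drop_id)
      then obtain p' where p': "tail_path \<Gamma> b (u @ [bar x]) p'" using tail_path_prefix[OF v] by blast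
      then have "p' = p" using ux tail_path_lpath lpath_det by blast
      then show False using p' no_path by blast
    qed
    have len: "length u = length v" using not_less[OF u v(1)] not_less[OF v u(1)] by simp
    then have "u = v"
      using tail_path_unique[OF False v(1) tail_path_lpath[OF u(1)] tail_path_reduced[OF u(1)]] by simp
    moreover have "r = q" using calculation u(1) v(1) tail_path_lpath lpath_det by blast
    ultimately have "bar x = bar y"
      using tail_path_forced[OF False u(1), of "bar x" "bar y"] u v by (auto simp: out_letters_def)
    then show "x = y" by simp
  qed
  have "card (out_letters p) \<le> card (core.out_letters p) + card E"
    unfolding out by (rule card_Un_le)
  then have le: "degree \<Gamma> p \<le> card (core.out_letters p) + card E" by (simp add: degree_out)
  show ?thesis
  proof (cases "E = {}")
    case True
    then show ?thesis using le deg by simp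
  next
    case nonempty: False
    then obtain x where x: "x \<in> E" by blast
    then have "E = {x}" using one by blast
    moreover have "degree \<Gamma> p \<noteq> 2"
      using reach[OF x] no_path tail_path_snoc[of \<Gamma> b] by metis
    ultimately show ?thesis using le deg by simp
  qed
qed

section \<open>The hull of a subgroup read off its Stallings graph\<close>

text \<open>Every core vertex has at least two letters, so a reduced path can always be prolonged by
  one that is not the inverse of its last letter.\<close>

lemma core_long_path:
  assumes "lstep (core \<Gamma> b) p x q"
  shows "\<exists>w r. lpath (core \<Gamma> b) p (x # w) r \<and> reduced (x # w) \<and> length w = n"
proof (induction n)
  case 0
  then show ?case
    using assms core.lpath_singleton by (intro exI[of _ "[]"]) (auto simp: reduced_Cons)
next
  case (Suc n)
  then obtain w r where w: "lpath (core \<Gamma> b) p (x # w) r" "reduced (x # w)" "length w = n" by blast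
  have "r \<in> verts (core \<Gamma> b)" using w(1) core.lpath_verts by blast
  then have "card (core.out_letters r) \<ge> 2" by (rule core_out_letters_card)
  then have "\<not> core.out_letters r \<subseteq> {bar (last (x # w))}"
    using card_mono[of "{bar (last (x # w))}" "core.out_letters r"] by auto
  then obtain y r' where y: "lstep (core \<Gamma> b) r y r'" "y \<noteq> bar (last (x # w))"
    by (auto simp: core.out_letters_def)
  have "lpath (core \<Gamma> b) p ((x # w) @ [y]) r'" using w(1) y(1) unfolding core.lpath_snoc by blast
  moreover have "reduced ((x # w) @ [y])" using w(2) y(2) unfolding reduced_snoc by blast
  ultimately show ?case using w(3) by (intro exI[of _ "w @ [y]"] exI[of _ r']) auto
qed

text \<open>Go on in the core for a long time, then return to \<open>b\<close> along a path of
  bounded length. The return cancels only letters at the far end, so the initial \<open>x\<close>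
  survives.\<close>

lemma core_long_return:
  assumes "lpath \<Gamma> b v p" "lstep (core \<Gamma> b) p x q"
  shows "\<exists>s\<in>H. n < length (reduce (winv v @ s)) \<and> hd (reduce (winv v @ s)) = x"
proof -
  obtain z where z: "\<And>r. r \<in> verts \<Gamma> \<Longrightarrow> lpath \<Gamma> r (z r) b"
    using connected[OF _ b_vert] by metis
  obtain N where N: "\<And>r. r \<in> verts \<Gamma> \<Longrightarrow> length (z r) \<le> N"
    using finite_nat_set_iff_bounded_le[of "(length \<circ> z) ` verts \<Gamma>"] finite_verts by auto
  obtain w r where w: "lpath (core \<Gamma> b) p (x # w) r" "reduced (x # w)" "length w = n + N"
    using core_long_path[OF assms(2)] by blast
  have r: "r \<in> verts \<Gamma>" using w(1) lpath_core lpath_verts by blast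
  let ?s = "reduce (v @ (x # w) @ z r)"
  have "lpath \<Gamma> b (v @ (x # w) @ z r) b"
    unfolding lpath_append using assms(1) lpath_core[OF w(1)] z[OF r] by blast
  then have "?s \<in> H" by (rule mem_if_lpath)
  moreover have "reduce (winv v @ ?s) = reduce ((x # w) @ z r)" by (rule reduce_winv_append)
  moreover have "hd (reduce ((x # w) @ z r)) = x \<and> n < length (reduce ((x # w) @ z r))"
    using reduce_append_short[OF w(2), of "z r"] N[OF r] w(3) by auto
  ultimately show ?thesis by metis
qed

text \<open>A suitable element of \<open>H\<close> passes through \<open>v\<close> without
  cancellation, so \<open>v\<close> is readable. At its end vertex, the tail offers a single
  direction for long reduced paths, while the core offers two.\<close>

lemma mem_hull_iff:
  "v \<in> hull A H \<longleftrightarrow> reduced v \<and> (\<exists>p\<in>verts (core \<Gamma> b). lpath \<Gamma> b v p)"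
proof
  assume v: "v \<in> hull A H"
  then have "v \<in> carrier (free_group A)" using hull_carrier by blast
  then have red: "reduced v" by (simp add: carrier_free_group)
  obtain s where s: "s \<in> H" "0 < length (reduce (winv v @ s))"
    "v \<noteq> [] \<longrightarrow> hd (reduce (winv v @ s)) \<noteq> bar (last v)"
    using hull_obtain_avoiding[OF v, of 0 "bar (last v)"] by blast
  let ?d = "reduce (winv v @ s)"
  \<comment> \<open>\<open>?d\<close> does not cancel against \<open>v\<close>, so \<open>v\<close>
    is a prefix of \<open>s\<close>, which labels a loop at \<open>b\<close>.\<close>
  have "reduce (v @ ?d) = s"
    using reduce_winv_append[of "winv v" s] s(1) H_carrier by (auto simp: carrier_free_group reduce_reduced)
  moreover have "reduced (v @ ?d)"
    using red s(2,3) by (auto simp: reduced_append reduced_reduce)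
  ultimately have "lpath \<Gamma> b (v @ ?d) b" using s(1) lpath_if_mem by (simp add: reduce_reduced)
  then obtain p where p: "lpath \<Gamma> b v p" by (auto simp: lpath_append)
  have "p \<in> verts (core \<Gamma> b)"
  proof (rule ccontr)
    assume "p \<notin> verts (core \<Gamma> b)"
    then have "p \<in> tail_verts \<Gamma> b" using p lpath_verts by (auto simp: verts_core)
    then obtain n where n: "\<And>w w' q q'. reduced w \<Longrightarrow> reduced w' \<Longrightarrow> lpath \<Gamma> p w q \<Longrightarrow>
        lpath \<Gamma> p w' q' \<Longrightarrow> n < length w \<Longrightarrow> n < length w' \<Longrightarrow> hd w = hd w'"
      using tail_long_paths_agree by blast
    obtain s s' where s: "s \<in> H" "s' \<in> H" "n < length (reduce (winv v @ s))"
      "n < length (reduce (winv v @ s'))" "hd (reduce (winv v @ s)) \<noteq> hd (reduce (winv v @ s'))"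
      using hullE[OF v, of n] by blast
    have "lpath \<Gamma> p (reduce (winv v @ s)) b" if "s \<in> H" for s
      using lpath_winv[OF p] lpath_if_mem[OF that] lpath_append by (intro lpath_reduce) blast
    then show False using n[OF reduced_reduce reduced_reduce] s by blast
  qed
  then show "reduced v \<and> (\<exists>p\<in>verts (core \<Gamma> b). lpath \<Gamma> b v p)" using red p by blast
next
  assume "reduced v \<and> (\<exists>p\<in>verts (core \<Gamma> b). lpath \<Gamma> b v p)"
  then obtain p where red: "reduced v" and p: "p \<in> verts (core \<Gamma> b)" "lpath \<Gamma> b v p" by blast
  have "\<not> card (core.out_letters p) \<le> 1" using core_out_letters_card[OF p(1)] by simp
  then obtain x y where "x \<in> core.out_letters p" "y \<in> core.out_letters p" "x \<noteq> y"
    using card_le_Suc0_iff_eq[of "core.out_letters p"] by (metis One_nat_def card.infinite zero_le)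
  then obtain q r where xy: "lstep (core \<Gamma> b) p x q" "lstep (core \<Gamma> b) p y r" "x \<noteq> y"
    by (auto simp: core.out_letters_def)
  show "v \<in> hull A H"
  proof (rule hullI)
    show "v \<in> carrier (free_group A)" using red p lpath_letters by (auto simp: carrier_free_group)
    show "\<exists>s\<in>H. \<exists>s'\<in>H. n < length (reduce (winv v @ s)) \<and>
      n < length (reduce (winv v @ s')) \<and> hd (reduce (winv v @ s)) \<noteq> hd (reduce (winv v @ s'))" for n
      using core_long_return[OF p(2) xy(1), of n] core_long_return[OF p(2) xy(2), of n] xy(3) by metis
  qed
qed

section \<open>The tail word as the shortest element of the hull\<close>

lemma
  shows tail_word_path: "lpath \<Gamma> b (tail_word \<Gamma> b) (tail_end \<Gamma> b)"
    and tail_end_core: "tail_end \<Gamma> b \<in> verts (core \<Gamma> b)"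
    and tail_word_minimal: "q \<in> verts (core \<Gamma> b) \<Longrightarrow> lpath \<Gamma> b w q \<Longrightarrow> length (tail_word \<Gamma> b) \<le> length w"
proof -
  let ?P = "\<lambda>w. \<exists>q\<in>verts (core \<Gamma> b). lpath \<Gamma> b w q"
  have "lpath \<Gamma> b (tail_word \<Gamma> b) (tail_end \<Gamma> b) \<and> tail_end \<Gamma> b \<in> verts (core \<Gamma> b) \<and>
    (\<forall>w. ?P w \<longrightarrow> length (tail_word \<Gamma> b) \<le> length w)"
  proof (cases "no_tail \<Gamma>")
    case True
    then show ?thesis using b_vert no_tail_core by (simp add: tail_word_def tail_end_def)
  next
    case False
    \<comment> \<open>The core is nonempty and the graph is connected, so the minimum in
      \<open>tail_word\<close> is taken over a nonempty set.\<close>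
    obtain q where "q \<in> verts (core \<Gamma> b)" using core_nonempty by blast
    then obtain w where "?P w" using connected[OF b_vert, of q] by (auto simp: verts_core)
    then have min: "?P (tail_word \<Gamma> b)" "\<forall>w. ?P w \<longrightarrow> length (tail_word \<Gamma> b) \<le> length w"
      using False arg_min_nat_lemma[of ?P w length] by (auto simp: tail_word_def)
    then have "\<exists>!q. q \<in> verts (core \<Gamma> b) \<and> lpath \<Gamma> b (tail_word \<Gamma> b) q"
      using lpath_det by blast
    from theI'[OF this] show ?thesis using min(2) False by (simp add: tail_end_def)
  qed
  then show "lpath \<Gamma> b (tail_word \<Gamma> b) (tail_end \<Gamma> b)" "tail_end \<Gamma> b \<in> verts (core \<Gamma> b)"
    "q \<in> verts (core \<Gamma> b) \<Longrightarrow> lpath \<Gamma> b w q \<Longrightarrow> length (tail_word \<Gamma> b) \<le> length w" by blast+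
qed

text \<open>Reduction keeps the end vertex, so by minimality it cannot shorten the tail
  word.\<close>

lemma tail_word_reduced: "reduced (tail_word \<Gamma> b)"
  using tail_word_minimal[OF tail_end_core lpath_reduce[OF tail_word_path]]
    length_reduce[of "tail_word \<Gamma> b"] by (intro length_reduce_eq) simp

lemma tail_word_hull: "tail_word \<Gamma> b \<in> hull A H"
  unfolding mem_hull_iff using tail_word_reduced tail_word_path tail_end_core by blast

lemma tail_word_shortest: "v \<in> hull A H \<Longrightarrow> length (tail_word \<Gamma> b) \<le> length v"
  using tail_word_minimal by (auto simp: mem_hull_iff)

text \<open>Cancellation at the junction would mean that the first core edge runs back along the
  last edge of the tail word, whose other end would then be a core vertex reached by a shorter
  word.\<close>

lemma tail_word_append_hull:
  assumes "u \<in> reduced_path_lang \<Gamma> b (tail_end \<Gamma> b)"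
  shows "tail_word \<Gamma> b @ u \<in> hull A H"
proof -
  let ?t = "tail_word \<Gamma> b"
  obtain q where u: "reduced u" "lpath (core \<Gamma> b) (tail_end \<Gamma> b) u q"
    using assms by (auto simp: reduced_path_lang_def path_lang_def)
  have "reduced (?t @ u)"
  proof (rule ccontr)
    assume "\<not> reduced (?t @ u)"
    then have nonempty: "?t \<noteq> []" "u \<noteq> []" and cancel: "hd u = bar (last ?t)"
      using tail_word_reduced u(1) by (auto simp: reduced_append)
    obtain r where r: "lstep (core \<Gamma> b) (tail_end \<Gamma> b) (hd u) r"
      using u(2) nonempty by (cases u) auto
    obtain r' where r': "lpath \<Gamma> b (butlast ?t) r'" "lstep \<Gamma> r' (last ?t) (tail_end \<Gamma> b)"
      using tail_word_path nonempty(1) lpath_snoc[of b "butlast ?t" "last ?t"] by auto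
    have "lstep \<Gamma> (tail_end \<Gamma> b) (hd u) r'" using r'(2) cancel by (simp add: lstep_bar)
    then have "r = r'" using r lstep_det by (auto simp: lstep_core)
    then have "length ?t \<le> length (butlast ?t)"
      using r r'(1) by (intro tail_word_minimal) (auto simp: lstep_core)
    then show False using nonempty(1) by (cases ?t rule: rev_cases) auto
  qed
  moreover have "lpath \<Gamma> b (?t @ u) q" using tail_word_path lpath_core[OF u(2)] by (auto simp: lpath_append)
  moreover have "q \<in> verts (core \<Gamma> b)" using u(2) core.lpath_verts by blast
  ultimately show ?thesis by (auto simp: mem_hull_iff)
qed

text \<open>The longest common prefix \<open>c\<close> lies on the geodesic from \<open>v\<close> to
  the tail word, hence in the hull by convexity; minimality of length then forces \<open>c\<close>
  to be the whole tail word.\<close>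

lemma tail_word_prefix:
  assumes v: "v \<in> hull A H"
  obtains u where "v = tail_word \<Gamma> b @ u"
proof -
  let ?t = "tail_word \<Gamma> b"
  obtain c t' v' where c: "?t = c @ t'" "v = c @ v'" "t' = [] \<or> v' = [] \<or> hd t' \<noteq> hd v'"
  proof -
    obtain c t' v' where "?t = c @ t'" "v = c @ v'" and "t' = [] \<or> v' = [] \<or> hd t' \<noteq> hd v'"
      using longest_common_prefix[of ?t v] by blast
    then show thesis by (rule that)
  qed
  have red: "reduced v" and sub: "set v \<subseteq> letters A"
    using subsetD[OF hull_carrier v] by (auto simp: carrier_free_group)
  have "reduce ?t \<in> hull A H" using tail_word_hull tail_word_reduced by (simp add: reduce_reduced)
  \<comment> \<open>The geodesic from \<open>v\<close> to the tail word first undoes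
    \<open>v'\<close> down to \<open>c\<close> and then follows \<open>t'\<close>.\<close>
  also have "reduce ?t = reduce (v @ winv v' @ t')"
  proof -
    have "reduce (v @ winv v' @ t') = reduce (c @ reduce (v' @ winv v' @ t'))"
      by (simp add: c(2) reduce_append_right)
    also have "reduce (v' @ winv v' @ t') = reduce t'"
      using reduce_winv_append[of "winv v'" t'] by (simp add: reduce_append_right)
    finally show ?thesis by (simp add: c(1) reduce_append_right)
  qed
  finally have 1: "reduce (v @ winv v' @ t') \<in> hull A H" .
  have 2: "reduced (winv v' @ t')"
    using red tail_word_reduced c by (auto simp: reduced_append last_winv)
  have "set (winv v') \<subseteq> letters A" using sub c(2) by (auto simp: set_winv)
  then have "reduce (v @ winv v') \<in> hull A H" by (rule hull_convex[OF v 1 2])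
  moreover have "reduce (v @ winv v') = reduce c"
  proof -
    have "reduce (v @ winv v') = reduce (c @ reduce (v' @ winv v'))"
      by (simp add: c(2) reduce_append_right)
    then show ?thesis using reduce_inverse[of "winv v'"] by (simp add: winv_def rev_map comp_def)
  qed
  moreover have "reduced c" using red c(2) by (simp add: reduced_append)
  ultimately have "c \<in> hull A H" by (simp add: reduce_reduced)
  then have "length ?t \<le> length c" by (rule tail_word_shortest)
  then show thesis using that c by simp
qed

text \<open>For a hull element \<open>v\<close>, convexity puts all points between the tail word and
  \<open>v\<close> into the hull, so the path of the remaining word \<open>u\<close> never leaves
  the core.\<close>

lemma hull_eq: "hull A H = (@) (tail_word \<Gamma> b) ` reduced_path_lang \<Gamma> b (tail_end \<Gamma> b)"
proof
  let ?t = "tail_word \<Gamma> b"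
  show "hull A H \<subseteq> (@) ?t ` reduced_path_lang \<Gamma> b (tail_end \<Gamma> b)"
  proof
    fix v assume v: "v \<in> hull A H"
    then obtain u where u: "v = ?t @ u" by (rule tail_word_prefix)
    have red: "reduced v" and sub: "set v \<subseteq> letters A"
      using subsetD[OF hull_carrier v] by (auto simp: carrier_free_group)
    have "\<exists>q. lpath (core \<Gamma> b) (tail_end \<Gamma> b) u1 q" if "u = u1 @ u2" for u1 u2
      using that
    proof (induction u1 arbitrary: u2 rule: rev_induct)
      case Nil
      then show ?case using tail_end_core by simp
    next
      case (snoc x u1)
      obtain q where q: "lpath (core \<Gamma> b) (tail_end \<Gamma> b) u1 q" using snoc.IH[of "x # u2"] snoc.prems by auto
      have "reduce (?t @ (u1 @ [x]) @ u2) \<in> hull A H"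
        using v red u snoc.prems by (simp add: reduce_reduced)
      moreover have "reduced ((u1 @ [x]) @ u2)" "set (u1 @ [x]) \<subseteq> letters A"
        using red sub u snoc.prems by (auto simp: reduced_append)
      ultimately have "reduce (?t @ u1 @ [x]) \<in> hull A H" by (rule hull_convex[OF tail_word_hull])
      moreover have "reduced ((?t @ u1 @ [x]) @ u2)" using red u snoc.prems by simp
      then have "reduced (?t @ u1 @ [x])" by (simp only: reduced_append)
      ultimately obtain r where r: "r \<in> verts (core \<Gamma> b)" "lpath \<Gamma> b (?t @ u1 @ [x]) r"
        by (auto simp: reduce_reduced mem_hull_iff)
      have "lpath \<Gamma> b (?t @ u1) q" using tail_word_path lpath_core[OF q] by (auto simp: lpath_append)
      then have "lstep \<Gamma> q x r"
        using r(2) lpath_det[of b "?t @ u1"] lpath_snoc[of b "?t @ u1" x r] by auto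
      moreover have "q \<in> verts (core \<Gamma> b)" using q core.lpath_verts by blast
      ultimately have "lstep (core \<Gamma> b) q x r" using r(1) by (simp add: lstep_core)
      then show ?case using q core.lpath_snoc by blast
    qed
    from this[of u "[]"] have "u \<in> path_lang \<Gamma> b (tail_end \<Gamma> b)" by (auto simp: path_lang_def)
    then show "v \<in> (@) ?t ` reduced_path_lang \<Gamma> b (tail_end \<Gamma> b)"
      using u red by (auto simp: reduced_path_lang_def reduced_append)
  qed
  show "(@) ?t ` reduced_path_lang \<Gamma> b (tail_end \<Gamma> b) \<subseteq> hull A H"
    using tail_word_append_hull by blast
qed

text \<open>The prefix criterion in the core expresses the full language by the reduced one, so
  equal reduced languages give equal full ones.\<close>

lemma path_lang_eq:
  "path_lang \<Gamma> b p = {w. \<forall>u v. w = u @ v \<longrightarrow> reduce u \<in> reduced_path_lang \<Gamma> b p}"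
proof -
  have "reduce u \<in> reduced_path_lang \<Gamma> b p \<longleftrightarrow> (\<exists>q. lpath (core \<Gamma> b) p (reduce u) q)" for u
    by (simp add: reduced_path_lang_def path_lang_def reduced_reduce)
  then show ?thesis
    unfolding path_lang_def by (subst core.readable_iff_reduced_prefixes_readable) (rule refl | simp only:)+
qed

section \<open>The maximum finite-index extension as a stabiliser\<close>

definition stab :: "'a letter list set" where
  "stab = {g \<in> carrier (free_group A). g <#\<^bsub>free_group A\<^esub> hull A H = hull A H}"

lemma subgroup_stab: "subgroup stab (free_group A)"
proof -
  interpret F: group "free_group A" by (rule group_free_group)
  have inv: "inv\<^bsub>free_group A\<^esub> g <#\<^bsub>free_group A\<^esub> hull A H = hull A H" if "g \<in> stab" for g
  proof -
    have g: "g \<in> carrier (free_group A)" "g <#\<^bsub>free_group A\<^esub> hull A H = hull A H"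
      using that by (auto simp: stab_def)
    have "inv\<^bsub>free_group A\<^esub> g <#\<^bsub>free_group A\<^esub> (g <#\<^bsub>free_group A\<^esub> hull A H) = hull A H"
      using g(1) by (simp add: F.lcos_m_assoc F.lcos_mult_one hull_carrier)
    then show ?thesis by (simp only: g(2))
  qed
  show ?thesis
  proof (rule F.subgroupI)
    show "stab \<subseteq> carrier (free_group A)" by (auto simp: stab_def)
    have "\<one>\<^bsub>free_group A\<^esub> \<in> stab" using F.lcos_mult_one[OF hull_carrier] by (simp add: stab_def)
    then show "stab \<noteq> {}" by blast
    show "inv\<^bsub>free_group A\<^esub> g \<in> stab" if "g \<in> stab" for g
      using that inv[OF that] by (auto simp: stab_def)
    show "g \<otimes>\<^bsub>free_group A\<^esub> h \<in> stab" if "g \<in> stab" "h \<in> stab" for g h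
      using that F.lcos_m_assoc[OF hull_carrier, of g h, symmetric] by (auto simp: stab_def)
  qed
qed

lemma lcoset_subgroup:
  assumes "subgroup G (free_group A)" "g \<in> G"
  shows "g <#\<^bsub>free_group A\<^esub> G = G"
  by (rule group.coset_join3[OF group_free_group subgroup.mem_carrier[OF assms] assms])

lemma H_subset_stab: "H \<subseteq> stab"
proof
  fix g assume g: "g \<in> H"
  then have "g \<in> carrier (free_group A)" using H_carrier by blast
  then show "g \<in> stab"
    using hull_lcoset[OF _ H_carrier, of g] lcoset_subgroup[OF subgroup g] by (simp add: stab_def)
qed

text \<open>An element of the stabiliser moves the tail word to a word readable from
  \<open>b\<close>. If two such words end at the same vertex, the elements lie in the same right
  coset of \<open>H\<close>, so there are at most as many cosets as vertices.\<close>

lemma finite_index_stab: "finite (rcosets\<^bsub>free_group A\<lparr>carrier := stab\<rparr>\<^esub> H)"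
proof -
  interpret F: group "free_group A" by (rule group_free_group)
  let ?t = "tail_word \<Gamma> b"
  \<comment> \<open>At a vertex that no translate of \<open>?t\<close> reaches, \<open>SOME\<close>
    gives an arbitrary value; this is harmless, as the cosets only have to be contained in the
    image.\<close>
  let ?C = "\<lambda>p. H #>\<^bsub>free_group A\<^esub> (SOME g. g \<in> stab \<and> lpath \<Gamma> b (g \<otimes>\<^bsub>free_group A\<^esub> ?t) p)"
  have t: "?t \<in> carrier (free_group A)" using tail_word_hull hull_carrier by blast
  have stabc: "g \<in> carrier (free_group A)" if "g \<in> stab" for g using that by (simp add: stab_def)
  have same: "H #>\<^bsub>free_group A\<^esub> g = H #>\<^bsub>free_group A\<^esub> h"
    if g: "g \<in> stab" "lpath \<Gamma> b (g \<otimes>\<^bsub>free_group A\<^esub> ?t) p"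
      and h: "h \<in> stab" "lpath \<Gamma> b (h \<otimes>\<^bsub>free_group A\<^esub> ?t) p" for g h p
  proof -
    let ?gt = "g \<otimes>\<^bsub>free_group A\<^esub> ?t" and ?ht = "h \<otimes>\<^bsub>free_group A\<^esub> ?t"
    \<comment> \<open>A path to \<open>p\<close> and another one back form a loop at
      \<open>b\<close>; in the product the factor \<open>?t\<close> cancels and leaves
      \<open>g\<close> times the inverse of \<open>h\<close>.\<close>
    have "lpath \<Gamma> b (?gt @ winv ?ht) b" using g h lpath_winv lpath_append by blast
    then have "reduce (?gt @ winv ?ht) \<in> H" by (rule mem_if_lpath)
    moreover have "?ht \<in> carrier (free_group A)" using stabc[OF h(1)] t by simp
    ultimately have "?gt \<otimes>\<^bsub>free_group A\<^esub> inv\<^bsub>free_group A\<^esub> ?ht \<in> H"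
      by (simp only: inv_free_group mult_free_group)
    moreover have "?gt \<otimes>\<^bsub>free_group A\<^esub> inv\<^bsub>free_group A\<^esub> ?ht = g \<otimes>\<^bsub>free_group A\<^esub> inv\<^bsub>free_group A\<^esub> h"
      using stabc[OF h(1)] stabc[OF g(1)] t
      by (simp add: F.inv_mult_group F.m_assoc F.inv_solve_left F.r_inv flip: F.m_assoc[of ?t])
    ultimately have "g \<otimes>\<^bsub>free_group A\<^esub> inv\<^bsub>free_group A\<^esub> h \<in> H" by simp
    then have "g \<otimes>\<^bsub>free_group A\<^esub> inv\<^bsub>free_group A\<^esub> h \<otimes>\<^bsub>free_group A\<^esub> h \<in> H #>\<^bsub>free_group A\<^esub> h"
      by (auto simp: r_coset_def)
    then have "g \<in> H #>\<^bsub>free_group A\<^esub> h"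
      using stabc[OF h(1)] stabc[OF g(1)] by (simp add: F.m_assoc)
    then show ?thesis using F.repr_independence[OF _ stabc[OF h(1)] subgroup] by simp
  qed
  have "rcosets\<^bsub>free_group A\<lparr>carrier := stab\<rparr>\<^esub> H \<subseteq> ?C ` verts \<Gamma>"
  proof
    fix X assume "X \<in> rcosets\<^bsub>free_group A\<lparr>carrier := stab\<rparr>\<^esub> H"
    then obtain g where g: "g \<in> stab" "X = H #>\<^bsub>free_group A\<^esub> g"
      by (auto simp: RCOSETS_def r_coset_def)
    have "g \<otimes>\<^bsub>free_group A\<^esub> ?t \<in> g <#\<^bsub>free_group A\<^esub> hull A H"
      using tail_word_hull by (auto simp: l_coset_def)
    then have "g \<otimes>\<^bsub>free_group A\<^esub> ?t \<in> hull A H" using g(1) by (simp add: stab_def)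
    then obtain p where p: "lpath \<Gamma> b (g \<otimes>\<^bsub>free_group A\<^esub> ?t) p" by (auto simp: mem_hull_iff)
    let ?g = "SOME g. g \<in> stab \<and> lpath \<Gamma> b (g \<otimes>\<^bsub>free_group A\<^esub> ?t) p"
    have "?g \<in> stab \<and> lpath \<Gamma> b (?g \<otimes>\<^bsub>free_group A\<^esub> ?t) p"
      using g(1) p by (intro someI) (rule conjI)
    then have "X = ?C p" using same[OF g(1) p] g(2) by blast
    then show "X \<in> ?C ` verts \<Gamma>" using p lpath_verts by blast
  qed
  then show ?thesis using finite_verts finite_surj by blast
qed

lemma fi_extension_stab: "fi_extension (free_group A) H stab"
  using subgroup_stab H_subset_stab finite_index_stab by (simp add: fi_extension_def)

text \<open>Every element of \<open>G\<close> is an element of \<open>H\<close> times one of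
  finitely many coset representatives, that is, a right factor of bounded length.\<close>

lemma hull_fi_extension:
  assumes "fi_extension (free_group A) H G"
  shows "hull A G = hull A H"
proof
  interpret F: group "free_group A" by (rule group_free_group)
  let ?FG = "free_group A\<lparr>carrier := G\<rparr>"
  have G: "subgroup G (free_group A)" "H \<subseteq> G" "finite (rcosets\<^bsub>?FG\<^esub> H)"
    using assms by (auto simp: fi_extension_def)
  have "\<forall>X\<in>rcosets\<^bsub>?FG\<^esub> H. \<exists>g. g \<in> G \<and> X = H #>\<^bsub>free_group A\<^esub> g"
    by (auto simp: RCOSETS_def r_coset_def)
  from bchoice[OF this] obtain r where
    r: "\<forall>X\<in>rcosets\<^bsub>?FG\<^esub> H. r X \<in> G \<and> X = H #>\<^bsub>free_group A\<^esub> r X" ..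
  show "hull A G \<subseteq> hull A H"
  proof (rule hull_bounded_perturbation)
    show "finite (r ` (rcosets\<^bsub>?FG\<^esub> H))" using G(3) by simp
    show "H \<subseteq> carrier (free_group A)" by (rule H_carrier)
    show "r ` (rcosets\<^bsub>?FG\<^esub> H) \<subseteq> carrier (free_group A)"
      using r subgroup.subset[OF G(1)] by blast
    fix s assume s: "s \<in> G"
    let ?X = "H #>\<^bsub>free_group A\<^esub> s"
    have X: "?X \<in> rcosets\<^bsub>?FG\<^esub> H" using s by (auto simp: RCOSETS_def r_coset_def)
    have "s \<in> ?X" using s subgroup.mem_carrier[OF G(1)] F.rcos_self[OF _ subgroup] by blast
    then have "s \<in> H #>\<^bsub>free_group A\<^esub> r ?X" using bspec[OF r X] by simp
    then show "\<exists>h\<in>H. \<exists>k\<in>r ` (rcosets\<^bsub>?FG\<^esub> H). s = h \<otimes>\<^bsub>free_group A\<^esub> k"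
      using X by (auto simp: r_coset_def)
  qed
  show "hull A H \<subseteq> hull A G" using G(2) by (rule hull_mono)
qed

text \<open>\<open>G\<close> is invariant under left translation by its own elements, hence so is
  its hull, which is the hull of \<open>H\<close>.\<close>

lemma fi_extension_subset_stab:
  assumes "fi_extension (free_group A) H G"
  shows "G \<subseteq> stab"
proof
  fix g assume g: "g \<in> G"
  have G: "subgroup G (free_group A)" using assms by (simp add: fi_extension_def)
  have "g <#\<^bsub>free_group A\<^esub> hull A G = hull A G"
    using hull_lcoset[OF subgroup.mem_carrier[OF G g] subgroup.subset[OF G]] lcoset_subgroup[OF G g]
    by simp
  then show "g \<in> stab"
    using g subgroup.mem_carrier[OF G] hull_fi_extension[OF assms] by (simp add: stab_def)
qed

text \<open>The stabiliser is a finite-index extension containing all others; antisymmetry of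
  inclusion gives the uniqueness that \<open>THE\<close> asks for.\<close>

lemma max_fi_extension_eq: "max_fi_extension (free_group A) H = stab"
  unfolding max_fi_extension_def
  by (intro the_equality)
    (simp_all add: fi_extension_stab fi_extension_subset_stab subset_antisym)

lemma hull_max_fi_extension: "hull A (max_fi_extension (free_group A) H) = hull A H"
  unfolding max_fi_extension_eq using fi_extension_stab by (rule hull_fi_extension)

end

section \<open>Comparison of the invariants of two subgroups\<close>

theorem proposition2p17:
  fixes A :: "'a set"
    and H K :: "'a letter list set"
    and \<Gamma>H :: "('v, 'a) lgraph" and bH :: 'v
    and \<Gamma>K :: "('w, 'a) lgraph" and bK :: 'w
  assumes "finite A"
    and "fin_gen_subgroup H (free_group A)" and "H \<noteq> {\<one>\<^bsub>free_group A\<^esub>}"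
    and "fin_gen_subgroup K (free_group A)" and "K \<noteq> {\<one>\<^bsub>free_group A\<^esub>}"
    and "stallings_graph A H \<Gamma>H bH"
    and "stallings_graph A K \<Gamma>K bK"
  shows "(max_fi_extension (free_group A) H = max_fi_extension (free_group A) K \<longleftrightarrow>
            tail_word \<Gamma>H bH = tail_word \<Gamma>K bK \<and>
            path_lang \<Gamma>H bH (tail_end \<Gamma>H bH) = path_lang \<Gamma>K bK (tail_end \<Gamma>K bK)) \<and>
         (tail_word \<Gamma>H bH = tail_word \<Gamma>K bK \<and>
            path_lang \<Gamma>H bH (tail_end \<Gamma>H bH) = path_lang \<Gamma>K bK (tail_end \<Gamma>K bK) \<longleftrightarrow>
          tail_word \<Gamma>H bH = tail_word \<Gamma>K bK \<and>
            reduced_path_lang \<Gamma>H bH (tail_end \<Gamma>H bH) = reduced_path_lang \<Gamma>K bK (tail_end \<Gamma>K bK))"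
  proof -
  have "subgroup H (free_group A)" "subgroup K (free_group A)"
    using assms(2,4) by (simp_all only: fin_gen_subgroup_def)
  then have "stallings A H \<Gamma>H bH" and "stallings A K \<Gamma>K bK"
    using assms(3,5,6,7) by (auto intro: stallings.intro)
  interpret H: stallings A H \<Gamma>H bH by fact
  interpret K: stallings A K \<Gamma>K bK by fact
  let ?tH = "tail_word \<Gamma>H bH" and ?tK = "tail_word \<Gamma>K bK"
  let ?LH = "reduced_path_lang \<Gamma>H bH (tail_end \<Gamma>H bH)"
    and ?LK = "reduced_path_lang \<Gamma>K bK (tail_end \<Gamma>K bK)"
  \<comment> \<open>The hull survives the passage to the maximum extension, and that extension is
    the stabiliser of the hull, so each determines the other.\<close>
  have fi_iff_hull: "max_fi_extension (free_group A) H = max_fi_extension (free_group A) K \<longleftrightarrow>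
      hull A H = hull A K"
  proof
    assume "max_fi_extension (free_group A) H = max_fi_extension (free_group A) K"
    then show "hull A H = hull A K"
      using H.hull_max_fi_extension K.hull_max_fi_extension by simp
  next
    assume "hull A H = hull A K"
    then show "max_fi_extension (free_group A) H = max_fi_extension (free_group A) K"
      by (simp only: H.max_fi_extension_eq K.max_fi_extension_eq H.stab_def K.stab_def)
  qed
  have hull_iff: "hull A H = hull A K \<longleftrightarrow> ?tH = ?tK \<and> ?LH = ?LK"
  proof
    assume eq: "hull A H = hull A K"
    \<comment> \<open>Inside the common hull \<open>?tK\<close> extends \<open>?tH\<close>, but it
      is no longer than \<open>?tH\<close>.\<close>
    have "?tK \<in> hull A H" using K.tail_word_hull eq by simp
    then obtain u where "?tK = ?tH @ u" by (rule H.tail_word_prefix)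
    moreover have "?tH \<in> hull A K" using H.tail_word_hull eq by simp
    then have "length ?tK \<le> length ?tH" by (rule K.tail_word_shortest)
    ultimately have t: "?tH = ?tK" by simp
    then have "(@) ?tH ` ?LH = (@) ?tH ` ?LK" using eq H.hull_eq K.hull_eq by simp
    then have "?LH = ?LK" by (subst (asm) inj_image_eq_iff) (auto simp: inj_on_def)
    then show "?tH = ?tK \<and> ?LH = ?LK" using t by blast
  next
    assume "?tH = ?tK \<and> ?LH = ?LK"
    then show "hull A H = hull A K" using H.hull_eq K.hull_eq by simp
  qed
  \<comment> \<open>One direction restricts to reduced words; the other is the prefix
    criterion.\<close>
  have lang_iff: "path_lang \<Gamma>H bH (tail_end \<Gamma>H bH) = path_lang \<Gamma>K bK (tail_end \<Gamma>K bK) \<longleftrightarrow> ?LH = ?LK"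
  proof
    assume "path_lang \<Gamma>H bH (tail_end \<Gamma>H bH) = path_lang \<Gamma>K bK (tail_end \<Gamma>K bK)"
    then show "?LH = ?LK" by (simp add: reduced_path_lang_def)
  next
    assume "?LH = ?LK"
    then show "path_lang \<Gamma>H bH (tail_end \<Gamma>H bH) = path_lang \<Gamma>K bK (tail_end \<Gamma>K bK)"
      unfolding H.path_lang_eq K.path_lang_eq by simp
  qed
  show ?thesis using fi_iff_hull hull_iff lang_iff by blast
qed

end
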